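(* Let $k\ge2$, $\boldsymbol\alpha\in\Delta$ and $\mathbf{n}=(n_r)_{r\ge0}=\Phi(\boldsymbol\alpha)$. (a) If $n_r>0$ for all $r\ge0$ and there is some $C$ such that $n_r\le Cr^2$ for all $r\ge1$, then $\boldsymbol\alpha$ is regular. (b) If $k\ge3$ and $n_r\ge 2^{r+2}\prod_{i=0}^{r-1}(n_i+2)$ for all $r\ge1$, then $\Phi^{-1}(\Phi(\boldsymbol\alpha))$ is a simplex of dimension $k-2$, so that $\boldsymbol\alpha$ is exceptional.
   Context: Fix an integer $k\ge 2$; $\mathbb{N}=\{0,1,2,\ldots\}$. Let $\Delta=\{\boldsymbol\alpha\in\mathbb{R}_{\ge0}^k:\alpha_k>0,\ \sum_i\alpha_i=1\}$. Let $J(\boldsymbol\alpha)=\lfloor\alpha_1/\alpha_k\rfloor$ and $\Delta_n=\{\boldsymbol\alpha\in\Delta:J(\boldsymbol\alpha)=n\}$ for $n\in\mathbb{N}$. Define $K_n:\Delta_n\to\Delta$ by $$K_n(\boldsymbol\alpha)=\frac{1}{1-\alpha_1}\bigl(\alpha_2,\alpha_3,\ldots,\alpha_{k-1},\ \alpha_1-n\alpha_k,\ (n+1)\alpha_k-\alpha_1\bigr),$$ $K:\Delta\to\Delta$ by $K(\boldsymbol\alpha)=K_{J(\boldsymbol\alpha)}(\boldsymbol\alpha)$, and the itinerary map $\Phi:\Delta\to\mathbb{N}^{\mathbb{N}}$ by $\Phi(\boldsymbol\alpha)_r=J(K^r(\boldsymbol\alpha))$. $\boldsymbol\alpha\in\Delta$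 is called regular if $\Phi^{-1}(\Phi(\boldsymbol\alpha))=\{\boldsymbol\alpha\}$, and exceptional otherwise. *)

theory Defs
  imports "HOL-Analysis.Analysis"
begin

text \<open>
  Vectors of dimension k are elements of \<open>real ^ 'i\<close>. The index type carries no
  structure of its own; the position of a coordinate is given by a numbering \<open>e\<close>, a bijection
  from \<open>{1..k}\<close> onto \<open>'i\<close> (so that \<open>CARD('i) = k\<close>), and \<open>\<alpha> $ e j\<close> is the j-th coordinate.
\<close>

definition Delta :: "nat \<Rightarrow> (nat \<Rightarrow> 'i) \<Rightarrow> (real ^ 'i::finite) set" where
  "Delta k e = {\<alpha>. (\<forall>j\<in>{1..k}. 0 \<le> \<alpha> $ e j) \<and> 0 < \<alpha> $ e k \<and> (\<Sum>j=1..k. \<alpha> $ e j) = 1}"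

definition J :: "nat \<Rightarrow> (nat \<Rightarrow> 'i) \<Rightarrow> real ^ 'i::finite \<Rightarrow> nat" where
  "J k e \<alpha> = nat \<lfloor>\<alpha> $ e 1 / \<alpha> $ e k\<rfloor>"

text \<open>The maps below are total; they are meaningful on \<open>Delta k e\<close> for \<open>k \<ge> 2\<close>, and
  \<open>K_branch k e n\<close> only where \<open>J k e \<alpha> = n\<close>.\<close>

definition K_branch :: "nat \<Rightarrow> (nat \<Rightarrow> 'i) \<Rightarrow> nat \<Rightarrow> real ^ 'i::finite \<Rightarrow> real ^ 'i" where
  "K_branch k e n \<alpha> = (1 / (1 - \<alpha> $ e 1)) *\<^sub>R
     (\<chi> i. let j = inv_into {1..k} e i in
        if j = k then (real n + 1) * \<alpha> $ e k - \<alpha> $ e 1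
        else if j = k - 1 then \<alpha> $ e 1 - real n * \<alpha> $ e k
        else \<alpha> $ e (j + 1))"

definition K :: "nat \<Rightarrow> (nat \<Rightarrow> 'i) \<Rightarrow> real ^ 'i::finite \<Rightarrow> real ^ 'i" where
  "K k e \<alpha> = K_branch k e (J k e \<alpha>) \<alpha>"

definition Phi :: "nat \<Rightarrow> (nat \<Rightarrow> 'i) \<Rightarrow> real ^ 'i::finite \<Rightarrow> nat \<Rightarrow> nat" where
  "Phi k e \<alpha> r = J k e ((K k e ^^ r) \<alpha>)"

definition Phi_fibre :: "nat \<Rightarrow> (nat \<Rightarrow> 'i) \<Rightarrow> (nat \<Rightarrow> nat) \<Rightarrow> (real ^ 'i::finite) set" where
  "Phi_fibre k e n = {\<beta> \<in> Delta k e. Phi k e \<beta> = n}"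

definition regular :: "nat \<Rightarrow> (nat \<Rightarrow> 'i) \<Rightarrow> real ^ 'i::finite \<Rightarrow> bool" where
  "regular k e \<alpha> \<longleftrightarrow> \<alpha> \<in> Delta k e \<and> Phi_fibre k e (Phi k e \<alpha>) = {\<alpha>}"

definition exceptional :: "nat \<Rightarrow> (nat \<Rightarrow> 'i) \<Rightarrow> real ^ 'i::finite \<Rightarrow> bool" where
  "exceptional k e \<alpha> \<longleftrightarrow> \<alpha> \<in> Delta k e \<and> \<not> regular k e \<alpha>"

end

theory Submission
  imports Defs "HOL-Real_Asymp.Real_Asymp"
begin

text \<open>
  Forget the normalisation in \<open>K\<close>: the branches become linear maps and the fibre over \<open>n\<close> is the set
  of vectors of coordinate sum 1 all of whose linear iterates are nonnegative. If \<open>z r\<close> is the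
  coordinate sum of the \<open>r\<close>-th iterate and \<open>L = k - 1\<close>, that iterate is
  \<open>(z r - z (r+1), \<dots>, z (r+L-1) - z (r+L), z (r+L))\<close>, and the dynamics is the recurrence
  \<open>z r - z (r+1) = n r * z (r+L) + (z (r+L) - z (r+L+1))\<close>.

  (a) Let \<open>M r\<close> and \<open>m r\<close> be the extreme ratios of the coordinates of two solutions. Nonnegative
  solutions have cross ratios of order at most \<open>r^2\<close> at stage \<open>r\<close>, so Birkhoff's theorem on the
  contraction of Hilbert's metric gives \<open>ln (M r / m r) \<le> (1 - c/r) * ln (M (r+2L) / m (r+2L))\<close>.
  As \<open>ln (M r / m r)\<close> itself is \<open>O(ln r)\<close> and \<open>\<Sum>1/r\<close> diverges, it vanishes at \<open>r = 0\<close>.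

  (b) The cones of vectors with nonnegative \<open>s\<close>-th iterate decrease with \<open>s\<close>. Their extreme rays
  \<open>v s, \<dots>, v (s+L-1), u s\<close> satisfy \<open>v (s+L) = (n s + 1) v s + u s\<close> and \<open>u (s+1) = n s * v s + u s\<close>.
  Rapid growth of \<open>n\<close> makes \<open>u s\<close> negligible against \<open>n s * v s\<close>, with summable errors, so the
  directions of \<open>v\<close> converge along each residue class mod \<open>L\<close>, while \<open>u\<close> gives no further limit.
  The limits stay close enough to the standard basis vectors to be linearly independent, and they
  span the fibre.
\<close>

section \<open>Birkhoff contraction\<close>

text \<open>The difference of the two sides vanishes at \<open>b = 1\<close> and has nonnegative
  derivative in \<open>b\<close>. For \<open>a = sqrt E\<close> the coefficient is Birkhoff's
  \<open>tanh (ln E / 4)\<close>.\<close>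

lemma birkhoff_scalar_bound:
  fixes a b :: real
  assumes "1 \<le> a" "1 \<le> b"
  shows "ln ((a * b + 1) / (a + b)) \<le> (a - 1) / (a + 1) * ln b"
proof -
  define h where "h = (\<lambda>t. (a - 1) / (a + 1) * ln t - ln (a * t + 1) + ln (a + t))"
  have "h 1 \<le> h b"
  proof (rule DERIV_nonneg_imp_nondecreasing [OF assms(2)])
    fix t :: real assume t: "1 \<le> t" "t \<le> b"
    have pos: "a * t + 1 > 0" "a + t > 0" "a + 1 > 0" "t > 0" 
      using assms t by (auto intro: add_pos_pos add_nonneg_pos)
    have "(h has_real_derivative (a - 1) / (a + 1) / t - a / (a * t + 1) + 1 / (a + t)) (at t)"
      unfolding h_def using pos by (auto intro!: derivative_eq_intros simp: divide_inverse)
    moreover have "(a - 1) / (a + 1) / t - a / (a * t + 1) + 1 / (a + t)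
        = (a - 1) * a * (t - 1)\<^sup>2 / ((a + 1) * t * (a * t + 1) * (a + t))"
      using pos by (simp add: divide_simps) algebra
    moreover have "\<dots> \<ge> 0" using pos assms by auto
    ultimately show "\<exists>y. (h has_real_derivative y) (at t) \<and> 0 \<le> y" by metis
  qed
  moreover have "h 1 = 0" by (simp add: h_def add.commute)
  moreover have "h b = (a - 1) / (a + 1) * ln b - ln ((a * b + 1) / (a + b))"
  proof -
    have "a * b + 1 > 0" "a + b > 0" using assms by (auto intro: add_nonneg_pos)
    then show ?thesis unfolding h_def by (simp add: ln_div)
  qed
  ultimately show ?thesis by linarith
qed

text \<open>The hypothesis \<open>cross\<close> bounds the cross ratio of the points
  \<open>m\<close>, \<open>s\<close>, \<open>t\<close>, \<open>M\<close>. The worst position of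
  \<open>s\<close> can be found explicitly, which leaves an estimate in \<open>sqrt E\<close> and
  \<open>sqrt (M / m)\<close> for \<open>birkhoff_scalar_bound\<close>.\<close>

lemma birkhoff_interval_contraction:
  fixes m s t M E :: real
  assumes "0 < m" "m \<le> s" "s \<le> t" "t \<le> M" "1 \<le> E"
    and cross: "(M - s) * (t - m) \<le> E * ((M - t) * (s - m))"
  shows "ln (t / s) \<le> (sqrt E - 1) / (sqrt E + 1) * ln (M / m)"
proof (cases "s = t")
  case True
  have "0 \<le> ln (M / m)" using assms by simp
  moreover have "0 \<le> (sqrt E - 1) / (sqrt E + 1)" using assms by simp
  ultimately show ?thesis using True assms by simp
next
  case False
  define a b where "a = sqrt E" and "b = sqrt (M / m)"
  have st: "s < t" using False assms by simp
  have a: "a \<ge> 1" and aE: "a\<^sup>2 = E" using assms by (auto simp: a_def)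
  have b: "b \<ge> 1" and bM: "b\<^sup>2 = M / m" using assms by (auto simp: b_def)
  have M: "M = b\<^sup>2 * m" using bM assms by (simp add: field_simps)
  have "(M - s) * (t - m) > 0" using assms st by simp
  hence "0 < E * ((M - t) * (s - m))" using cross by linarith
  hence "M - t > 0" "s - m > 0" using assms by (auto simp: zero_less_mult_iff)
  \<comment> \<open>Rescaling by \<open>m\<close> turns the outer interval into
    \<open>[1, b^2]\<close>; the cross ratio condition then bounds \<open>T\<close> by a fractional
    linear function of \<open>S\<close> with denominator \<open>Q\<close>.\<close>
  define S T where "S = s / m" and "T = t / m"
  have sS: "s = S * m" and tT: "t = T * m" using assms by (auto simp: S_def T_def)
  have S: "1 < S" "S < b\<^sup>2" using \<open>s - m > 0\<close> \<open>M - t > 0\<close> st assms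
    by (auto simp: S_def bM divide_simps)
  define Q where "Q = (b\<^sup>2 - S) + a\<^sup>2 * (S - 1)"
  have Q: "Q > 0" unfolding Q_def using S a by (intro add_pos_nonneg) auto
  have "m\<^sup>2 * ((b\<^sup>2 - S) * (T - 1)) \<le> m\<^sup>2 * (a\<^sup>2 * ((b\<^sup>2 - T) * (S - 1)))"
    using cross unfolding sS tT M aE[symmetric] by (simp add: algebra_simps power2_eq_square)
  hence "(b\<^sup>2 - S) * (T - 1) \<le> a\<^sup>2 * ((b\<^sup>2 - T) * (S - 1))" using assms by simp
  hence TQ: "T * Q \<le> a\<^sup>2 * b\<^sup>2 * (S - 1) + (b\<^sup>2 - S)" unfolding Q_def by (simp add: algebra_simps)
  have "(T * Q) * (a + b)\<^sup>2 \<le> (a\<^sup>2 * b\<^sup>2 * (S - 1) + (b\<^sup>2 - S)) * (a + b)\<^sup>2"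
    by (intro mult_right_mono TQ) auto
  \<comment> \<open>The subtracted square vanishes at \<open>S = b * (a + b) / (1 + a * b)\<close>,
    where \<open>T / S\<close> can reach its maximum
    \<open>((a * b + 1) / (a + b))^2\<close>.\<close>
  also have "\<dots> = S * (a * b + 1)\<^sup>2 * Q - (a\<^sup>2 - 1) * ((1 + a * b) * S - b * (a + b))\<^sup>2"
    unfolding Q_def by algebra
  also have "\<dots> \<le> S * (a * b + 1)\<^sup>2 * Q" using a by simp
  finally have "(T * (a + b)\<^sup>2) * Q \<le> (S * (a * b + 1)\<^sup>2) * Q" by (simp add: mult_ac)
  hence "T * (a + b)\<^sup>2 \<le> S * (a * b + 1)\<^sup>2" using Q by simp
  hence key: "t * (a + b)\<^sup>2 \<le> s * (a * b + 1)\<^sup>2"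
    unfolding sS tT using assms by (simp add: mult.commute mult.left_commute)
  have ab: "a + b > 0" "a * b + 1 > 0" using a b by (auto intro: add_nonneg_pos)
  have "t / s \<le> ((a * b + 1) / (a + b))\<^sup>2"
    using key ab assms by (simp add: power_divide divide_simps mult.commute)
  hence "ln (t / s) \<le> ln (((a * b + 1) / (a + b))\<^sup>2)"
    using assms st ab by (subst ln_le_cancel_iff) auto
  also have "\<dots> = 2 * ln ((a * b + 1) / (a + b))" using ab by (simp add: ln_realpow)
  also have "\<dots> \<le> (a - 1) / (a + 1) * (2 * ln b)"
    using mult_left_mono[OF birkhoff_scalar_bound[OF a b], of 2] by (simp only: mult_ac)
  also have "2 * ln b = ln (M / m)" using b by (simp add: ln_realpow flip: bM)
  finally show ?thesis by (simp add: a_def)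
qed

text \<open>Each factor \<open>1 - c / (R + 1)\<close> is at most
  \<open>((R + 2) / (R + 1)) powr - c\<close>, so iteration telescopes to
  \<open>h 0 \<le> (R + 1) powr - c * h R\<close>, and the power decay beats the logarithmic growth
  of \<open>h\<close>.\<close>

lemma slow_contraction_imp_zero:
  fixes h :: "nat \<Rightarrow> real"
  assumes c: "0 < c" 
    and nonneg: "\<And>i. 0 \<le> h i"
    and contr: "\<And>i. h i \<le> (1 - c / real (i + 1)) * h (Suc i)"
    and growth: "\<And>i. h i \<le> A + B * ln (real (i + 1))"
  shows "h 0 = 0"
proof -
  have bd: "h 0 \<le> real (R + 1) powr - c * h R" for R
  proof (induction R)
    case (Suc R)
    have "ln (real (R + 2) / real (R + 1)) \<le> real (R + 2) / real (R + 1) - 1"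
      by (rule ln_le_minus_one) auto
    hence l: "ln (real (R + 2)) - ln (real (R + 1)) \<le> 1 / real (R + 1)"
      by (simp add: ln_div field_simps)
    have "1 - c / real (R + 1) \<le> exp (- (c / real (R + 1)))"
      using exp_ge_add_one_self[of "- (c / real (R + 1))"] by simp
    also have "\<dots> \<le> exp (- c * (ln (real (R + 2)) - ln (real (R + 1))))"
      using mult_left_mono[OF l, of c] c by simp
    finally have "real (R + 1) powr - c * (1 - c / real (R + 1))
      \<le> real (R + 1) powr - c * exp (- c * (ln (real (R + 2)) - ln (real (R + 1))))"
      by (intro mult_left_mono) auto
    also have "\<dots> = real (Suc R + 1) powr - c"
      by (simp add: powr_def field_simps flip: exp_add)
    finally have *: "real (R + 1) powr - c * (1 - c / real (R + 1)) \<le> real (Suc R + 1) powr - c" .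
    have "h 0 \<le> real (R + 1) powr - c * ((1 - c / real (R + 1)) * h (Suc R))"
      using Suc contr[of R] by (meson order_trans mult_left_mono powr_ge_zero)
    also have "\<dots> \<le> real (Suc R + 1) powr - c * h (Suc R)"
      using mult_right_mono[OF * nonneg[of "Suc R"]] by (simp only: mult.assoc)
    finally show ?case .
  qed simp
  have "h 0 \<le> real (R + 1) powr - c * (A + B * ln (real (R + 1)))" for R
    using bd[of R] growth[of R] by (meson order_trans mult_left_mono powr_ge_zero)
  moreover have "(\<lambda>R. real (R + 1) powr - c * (A + B * ln (real (R + 1)))) \<longlonglongrightarrow> 0"
    using c by real_asymp
  ultimately have "h 0 \<le> 0"
    by (intro LIMSEQ_le_const[where X="(\<lambda>R. real (R + 1) powr - c * (A + B * ln (real (R + 1))))"]) auto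
  with nonneg[of 0] show ?thesis by simp
qed

section \<open>Nonnegative solutions of the itinerary recurrence\<close>

definition itinerary_rec :: "nat \<Rightarrow> (nat \<Rightarrow> nat) \<Rightarrow> (nat \<Rightarrow> real) \<Rightarrow> bool" where
  "itinerary_rec L n z \<longleftrightarrow>
     (\<forall>r. z r - z (Suc r) = real (n r) * z (r + L) + (z (r + L) - z (Suc (r + L))))"

definition nonneg_stage :: "nat \<Rightarrow> (nat \<Rightarrow> real) \<Rightarrow> nat \<Rightarrow> bool" where
  "nonneg_stage L z s \<longleftrightarrow> 0 \<le> z (s + L) \<and> (\<forall>j\<in>{s..<s + L}. z (Suc j) \<le> z j)"

text \<open>Coordinates are counted from 0 to \<open>L\<close>, one less than in the numbering
  \<open>e\<close>. Entry \<open>L\<close> is the whole remainder, so that the entries add up to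
  \<open>z r\<close>.\<close>

definition stage_coord :: "nat \<Rightarrow> (nat \<Rightarrow> real) \<Rightarrow> nat \<Rightarrow> nat \<Rightarrow> real" where
  "stage_coord L z r j = (if j < L then z (r + j) - z (Suc (r + j)) else z (r + L))"

lemma itinerary_rec_diff:
  assumes "itinerary_rec L n w" "itinerary_rec L n w'"
  shows "itinerary_rec L n (\<lambda>t. a * w t - b * w' t)"
  unfolding itinerary_rec_def
proof
  fix t
  have "w t - w (Suc t) = real (n t) * w (t + L) + (w (t + L) - w (Suc (t + L)))"
    "w' t - w' (Suc t) = real (n t) * w' (t + L) + (w' (t + L) - w' (Suc (t + L)))"
    using assms unfolding itinerary_rec_def by blast+
  then show "(a * w t - b * w' t) - (a * w (Suc t) - b * w' (Suc t)) =
      real (n t) * (a * w (t + L) - b * w' (t + L))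
      + ((a * w (t + L) - b * w' (t + L)) - (a * w (Suc (t + L)) - b * w' (Suc (t + L))))"
    by algebra
qed

lemma nonneg_stage_iff: "nonneg_stage L z s \<longleftrightarrow> (\<forall>j\<le>L. 0 \<le> stage_coord L z s j)"
proof -
  have "(\<forall>j\<in>{s..<s + L}. z (Suc j) \<le> z j) \<longleftrightarrow> (\<forall>j<L. z (Suc (s + j)) \<le> z (s + j))"
  proof (intro iffI ballI allI impI)
    fix j assume a: "\<forall>j<L. z (Suc (s + j)) \<le> z (s + j)" "j \<in> {s..<s + L}"
    then have "j - s < L" "s + (j - s) = j" by auto
    then show "z (Suc j) \<le> z j" using a(1) by metis
  qed auto
  moreover have "(\<forall>j\<le>L. 0 \<le> stage_coord L z s j) \<longleftrightarrow> (\<forall>j<L. 0 \<le> stage_coord L z s j) \<and> 0 \<le> stage_coord L z s L"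
    by (auto simp: le_less)
  ultimately show ?thesis by (auto simp: nonneg_stage_def stage_coord_def)
qed

text \<open>One step back the only new coordinate is \<open>z s - z (Suc s)\<close>, and the
  recurrence writes it with nonnegative coefficients in the others: inverse branches are nonnegative
  matrices.\<close>

lemma nonneg_stage_Suc:
  assumes "itinerary_rec L n z" "1 \<le> L" "nonneg_stage L z (Suc s)"
  shows "nonneg_stage L z s"
proof -
  have last: "z (Suc (s + L)) \<le> z (s + L)" "0 \<le> z (Suc (s + L))"
    using assms(2,3) by (auto simp: nonneg_stage_def)
  have "z s - z (Suc s) = real (n s) * z (s + L) + (z (s + L) - z (Suc (s + L)))"
    using assms(1) unfolding itinerary_rec_def by blast
  moreover have "0 \<le> real (n s) * z (s + L)" using last by simp
  ultimately have first: "z (Suc s) \<le> z s" using last by linarith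
  have "z (Suc j) \<le> z j" if "j \<in> {s..<s + L}" for j
  proof (cases "j = s")
    case False
    then show ?thesis using assms(3) that by (auto simp: nonneg_stage_def)
  qed (use first in simp)
  then show ?thesis using last by (auto simp: nonneg_stage_def)
qed

lemma nonneg_stage_antimono:
  assumes "itinerary_rec L n z" "1 \<le> L" "nonneg_stage L z s" "t \<le> s"
  shows "nonneg_stage L z t"
  using assms(4,3)
  by (induction rule: inc_induct) (use nonneg_stage_Suc[OF assms(1,2)] in auto)

text \<open>Every drop that starts below \<open>s + L\<close> is a coordinate of some stage up to
  \<open>s\<close>, and all those stages are nonnegative.\<close>

lemma nonneg_stage_decreasing:
  assumes "itinerary_rec L n z" "1 \<le> L" "nonneg_stage L z s" "i \<le> j" "j \<le> s + L"
  shows "z j \<le> z i"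
proof -
  have step: "z (Suc m) \<le> z m" if "m < s + L" for m
  proof (cases "m \<le> s")
    case True
    have "nonneg_stage L z m" by (rule nonneg_stage_antimono[OF assms(1,2,3) True])
    then show ?thesis using assms(2) by (auto simp: nonneg_stage_def)
  next
    case False
    then show ?thesis using assms(3) that by (auto simp: nonneg_stage_def)
  qed
  show ?thesis using assms(4,5)
    by (induction rule: dec_induct) (auto intro: order_trans[OF step])
qed

lemma nonneg_stage_nonneg:
  assumes "itinerary_rec L n z" "1 \<le> L" "nonneg_stage L z s" "j \<le> s + L"
  shows "0 \<le> z j"
  using nonneg_stage_decreasing[OF assms(1-3,4) order_refl] assms(3)
  by (auto simp: nonneg_stage_def)

section \<open>Cross ratios of nonnegative solutions for positive itineraries\<close>

context
  fixes L :: nat and n :: "nat \<Rightarrow> nat"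
  assumes L: "1 \<le> L" and n: "\<And>r. 0 < n r"
begin

text \<open>Monotonicity confines the last term of the recurrence to \<open>[0, z (i + L)]\<close>.
  As \<open>n i\<close> is at least 1, the drop is \<open>n i * z (i + L)\<close> up to a factor
  2.\<close>

lemma decrement_bounds:
  assumes "itinerary_rec L n z" "nonneg_stage L z s" "i < s"
  shows "real (n i) * z (i + L) \<le> z i - z (Suc i)"
    and "z i - z (Suc i) \<le> (real (n i) + 1) * z (i + L)"
    and "z i - z (Suc i) \<le> 2 * (real (n i) * z (i + L))"
proof -
  have eq: "z i - z (Suc i) = real (n i) * z (i + L) + (z (i + L) - z (Suc (i + L)))"
    using assms(1) unfolding itinerary_rec_def by blast
  have 1: "z (Suc (i + L)) \<le> z (i + L)"
    by (rule nonneg_stage_decreasing[OF assms(1) L assms(2)]) (use assms(3) in auto)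
  have 2: "0 \<le> z (Suc (i + L))" "0 \<le> z (i + L)"
    by (rule nonneg_stage_nonneg[OF assms(1) L assms(2)], use assms(3) in simp)+
  show "real (n i) * z (i + L) \<le> z i - z (Suc i)" using eq 1 by simp
  show *: "z i - z (Suc i) \<le> (real (n i) + 1) * z (i + L)" using eq 2 by (simp add: algebra_simps)
  have "1 * z (i + L) \<le> real (n i) * z (i + L)"
    using n[of i] 2 by (intro mult_right_mono) auto
  with * show "z i - z (Suc i) \<le> 2 * (real (n i) * z (i + L))" by (simp add: algebra_simps)
qed

definition spread :: "nat \<Rightarrow> real" where
  "spread r = 1 + (\<Sum>j<L. real (n (r + L + j)) + 1)"

lemma spread_ge_1: "1 \<le> spread r"
  unfolding spread_def by (simp add: sum_nonneg)

text \<open>The drops across the window telescope, and each is at most its \<open>n + 1\<close>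
  times a value no larger than \<open>z (r + 2 * L)\<close>, which in turn is below every value in
  the window.\<close>

lemma window_spread:
  assumes "itinerary_rec L n z" "nonneg_stage L z (r + 2 * L)"
    "a \<in> {r + L..<r + 2 * L}" "b \<in> {r + L..<r + 2 * L}"
  shows "z a \<le> spread r * z b"
proof -
  let ?y = "z (r + 2 * L)"
  have tele: "z (r + L) - z (r + L + m) = (\<Sum>j<m. z (r + L + j) - z (Suc (r + L + j)))" for m
    by (induction m) auto
  have "z (r + L) - ?y = (\<Sum>j<L. z (r + L + j) - z (Suc (r + L + j)))"
    using tele[of L] by (simp add: mult_2 add.assoc)
  also have "\<dots> \<le> (\<Sum>j<L. (real (n (r + L + j)) + 1) * ?y)"
  proof (rule sum_mono)
    fix j assume j: "j \<in> {..<L}"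
    have "z (r + L + j) - z (Suc (r + L + j)) \<le> (real (n (r + L + j)) + 1) * z (r + L + j + L)"
      by (rule decrement_bounds(2)[OF assms(1,2)]) (use j in auto)
    also have "\<dots> \<le> (real (n (r + L + j)) + 1) * ?y"
      by (intro mult_left_mono nonneg_stage_decreasing[OF assms(1) L assms(2)]) (use j in auto)
    finally show "z (r + L + j) - z (Suc (r + L + j)) \<le> (real (n (r + L + j)) + 1) * ?y" .
  qed
  also have "\<dots> = (\<Sum>j<L. real (n (r + L + j)) + 1) * ?y" by (simp only: sum_distrib_right)
  finally have "z (r + L) \<le> spread r * ?y"
    unfolding spread_def by (simp only: distrib_right mult_1)
  moreover have "z a \<le> z (r + L)"
    by (rule nonneg_stage_decreasing[OF assms(1) L assms(2)]) (use assms in auto)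
  moreover have "spread r * ?y \<le> spread r * z b"
    by (intro mult_left_mono nonneg_stage_decreasing[OF assms(1) L assms(2)])
       (use assms spread_ge_1[of r] in auto)
  ultimately show ?thesis by linarith
qed

text \<open>Only one of the two solutions needs its spread, since the order of \<open>a\<close> and
  \<open>b\<close> makes the other monotone in the right direction. Having \<open>spread r\<close>
  and not its square is what leaves a contraction defect of order \<open>1 / r\<close>, with
  divergent sum, under quadratic growth.\<close>

lemma window_cross_ratio:
  assumes "itinerary_rec L n p" "nonneg_stage L p (r + 2 * L)"
    "itinerary_rec L n q" "nonneg_stage L q (r + 2 * L)"
    "a \<in> {r + L..<r + 2 * L}" "b \<in> {r + L..<r + 2 * L}"
  shows "p a * q b \<le> spread r * (p b * q a)"
proof -
  have nn: "0 \<le> p c" "0 \<le> q c" if "c \<in> {r + L..<r + 2 * L}" for c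
    using nonneg_stage_nonneg[OF assms(1) L assms(2)] nonneg_stage_nonneg[OF assms(3) L assms(4)] that
    by auto
  show ?thesis
  proof (cases "a \<le> b")
    case True
    have "q b \<le> q a"
      by (rule nonneg_stage_decreasing[OF assms(3) L assms(4) True]) (use assms in auto)
    then have "p a * q b \<le> (spread r * p b) * q a"
      using window_spread[OF assms(1,2,5,6)] nn[OF assms(5)] nn[OF assms(6)]  spread_ge_1[of r]
      by (intro mult_mono) auto
    then show ?thesis by (simp add: mult_ac)
  next
    case False
    have "p a \<le> p b"
      by (rule nonneg_stage_decreasing[OF assms(1) L assms(2)]) (use assms False in auto)
    then have "p a * q b \<le> p b * (spread r * q a)"
      using window_spread[OF assms(3,4,6,5)] nn[OF assms(5)] nn[OF assms(6)]
      by (intro mult_mono) auto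
    then show ?thesis by (simp add: mult_ac)
  qed
qed

text \<open>Coordinate \<open>i\<close> is \<open>f i * z (g i)\<close> up to a factor 2. The weight
  \<open>f i\<close> depends on the itinerary alone and cancels in a cross ratio, and
  \<open>g i\<close> lies in the window. The 4 collects the two factors 2 lost on the left-hand
  side. The inequality is multiplied out because coordinates may vanish.\<close>

lemma stage_coord_cross_ratio:
  assumes "itinerary_rec L n p" "nonneg_stage L p (r + 2 * L)"
    "itinerary_rec L n q" "nonneg_stage L q (r + 2 * L)" "i \<le> L" "j \<le> L"
  shows "stage_coord L p r i * stage_coord L q r j
           \<le> 4 * spread r * (stage_coord L p r j * stage_coord L q r i)"
proof -
  define g where "g = (\<lambda>i. if i < L then r + i + L else r + L)"
  define f where "f = (\<lambda>i. if i < L then real (n (r + i)) else 1)"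
  have g: "g i \<in> {r + L..<r + 2 * L}" if "i \<le> L" for i
    using L by (auto simp: g_def)
  have f: "0 \<le> f i" for i by (auto simp: f_def)
  have bounds: "0 \<le> z (g i) \<and> f i * z (g i) \<le> stage_coord L z r i
      \<and> stage_coord L z r i \<le> 2 * (f i * z (g i))"
    if "itinerary_rec L n z" "nonneg_stage L z (r + 2 * L)" "i \<le> L" for z i
  proof -
    have "0 \<le> z (g i)"
      by (rule nonneg_stage_nonneg[OF that(1) L that(2)]) (use g[OF that(3)] in auto)
    then show ?thesis
      using decrement_bounds(1,3)[OF that(1,2), of "r + i"] L
      by (auto simp: stage_coord_def g_def f_def)
  qed
  note pi = bounds[OF assms(1,2,5)] and pj = bounds[OF assms(1,2,6)]
    and qi = bounds[OF assms(3,4,5)] and qj = bounds[OF assms(3,4,6)]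
  have nn: "0 \<le> f i * p (g i)" "0 \<le> f j * p (g j)" "0 \<le> f i * q (g i)" "0 \<le> f j * q (g j)"
    using pi pj qi qj f by auto
  have "stage_coord L p r i * stage_coord L q r j \<le> (2 * (f i * p (g i))) * (2 * (f j * q (g j)))"
    using pi qj nn by (intro mult_mono) auto
  also have "\<dots> = 4 * (f i * f j) * (p (g i) * q (g j))" by simp
  also have "\<dots> \<le> 4 * (f i * f j) * (spread r * (p (g j) * q (g i)))"
    using window_cross_ratio[OF assms(1-4) g[OF assms(5)] g[OF assms(6)]] f
    by (intro mult_left_mono) auto
  also have "\<dots> = 4 * spread r * ((f j * p (g j)) * (f i * q (g i)))" by simp
  also have "\<dots> \<le> 4 * spread r * (stage_coord L p r j * stage_coord L q r i)"
    using pj qi nn spread_ge_1[of r] by (intro mult_left_mono mult_mono) auto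
  finally show ?thesis .
qed


section \<open>Contraction of the coordinate ratios of two positive solutions\<close>

context
  fixes z z' :: "nat \<Rightarrow> real"
  assumes rec: "itinerary_rec L n z" "itinerary_rec L n z'"
    and nonneg: "\<And>s. nonneg_stage L z s" "\<And>s. nonneg_stage L z' s"
    and pos: "\<And>s. 0 < z s" "\<And>s. 0 < z' s"
begin

definition coord_ratio :: "nat \<Rightarrow> nat \<Rightarrow> real" where
  "coord_ratio r j = stage_coord L z r j / stage_coord L z' r j"

text \<open>With \<open>min_ratio\<close>, this gives the Hilbert distance of the two solutions at
  stage \<open>r\<close> as \<open>ln (max_ratio r / min_ratio r)\<close>.\<close>

definition max_ratio :: "nat \<Rightarrow> real" where
  "max_ratio r = Max (coord_ratio r ` {..L})"

definition min_ratio :: "nat \<Rightarrow> real" where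
  "min_ratio r = Min (coord_ratio r ` {..L})"

lemma stage_coord_pos:
  assumes "j \<le> L"
  shows "0 < stage_coord L z r j" "0 < stage_coord L z' r j"
proof -
  have "0 < stage_coord L w r j"
    if w: "itinerary_rec L n w" "\<And>s. nonneg_stage L w s" "\<And>s. 0 < w s" for w
  proof (cases "j < L")
    case True
    have "real (n (r + j)) * w (r + j + L) \<le> w (r + j) - w (Suc (r + j))"
      by (rule decrement_bounds(1)[OF w(1) w(2)[of "Suc (r + j)"]]) simp
    moreover have "0 < real (n (r + j)) * w (r + j + L)" using n w(3) by simp
    ultimately show ?thesis using True by (simp add: stage_coord_def)
  qed (use w(3) in \<open>simp add: stage_coord_def\<close>)
  then show "0 < stage_coord L z r j" "0 < stage_coord L z' r j"
    using rec nonneg pos by blast+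
qed

lemma coord_ratio_bounds:
  assumes "j \<le> L"
  shows "min_ratio r \<le> coord_ratio r j" "coord_ratio r j \<le> max_ratio r"
  using assms by (auto simp: min_ratio_def max_ratio_def)

lemma max_ratio_attained: obtains j where "j \<le> L" "max_ratio r = coord_ratio r j"
proof -
  have "max_ratio r \<in> coord_ratio r ` {..L}" unfolding max_ratio_def by (intro Max_in) auto
  with that show ?thesis by auto
qed

lemma min_ratio_attained: obtains j where "j \<le> L" "min_ratio r = coord_ratio r j"
proof -
  have "min_ratio r \<in> coord_ratio r ` {..L}" unfolding min_ratio_def by (intro Min_in) auto
  with that show ?thesis by auto
qed

lemma min_ratio_pos: "0 < min_ratio r"
  by (rule min_ratio_attained[of r]) (simp add: coord_ratio_def stage_coord_pos)

lemma min_le_max_ratio: "min_ratio r \<le> max_ratio r"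
  using coord_ratio_bounds[of 0 r] by simp

text \<open>The contraction runs from late stages to early ones and so needs an a priori bound at
  late stages; the cross ratio bound for \<open>z\<close> and \<open>z'\<close> themselves provides
  it.\<close>

lemma cross_ratio_of_solutions: "max_ratio r / min_ratio r \<le> 4 * spread r"
proof -
  obtain i where i: "i \<le> L" "max_ratio r = coord_ratio r i" by (rule max_ratio_attained)
  obtain j where j: "j \<le> L" "min_ratio r = coord_ratio r j" by (rule min_ratio_attained)
  note ij = i j
  show ?thesis
    using stage_coord_cross_ratio[OF rec(1) nonneg(1) rec(2) nonneg(2) ij(1,3)]
      stage_coord_pos[OF ij(1)] stage_coord_pos[OF ij(3)]
    unfolding ij(2,4) coord_ratio_def by (simp add: field_simps)
qed

text \<open>By the choice of the extreme ratios, \<open>p\<close> and \<open>q\<close> are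
  nonnegative at stage \<open>s\<close>. Their cross ratio bound at stage \<open>r\<close>, taken at
  the extremal coordinates \<open>i\<close> and \<open>j\<close> and divided by
  \<open>b i * b j\<close>, is the hypothesis \<open>cross\<close> for the interval of ratios at
  \<open>r\<close> inside that at \<open>s\<close>.\<close>

lemma ratio_contraction:
  defines "E \<equiv> \<lambda>r. 4 * spread r"
  shows "ln (max_ratio r / min_ratio r)
    \<le> (sqrt (E r) - 1) / (sqrt (E r) + 1) * ln (max_ratio (r + 2 * L) / min_ratio (r + 2 * L))"
proof -
  define s where "s = r + 2 * L"
  define p where "p = (\<lambda>t. max_ratio s * z' t - z t)"
  define q where "q = (\<lambda>t. z t - min_ratio s * z' t)"
  have cp: "stage_coord L p t j = max_ratio s * stage_coord L z' t j - stage_coord L z t j" for t j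
    by (simp add: stage_coord_def p_def algebra_simps)
  have cq: "stage_coord L q t j = stage_coord L z t j - min_ratio s * stage_coord L z' t j" for t j
    by (simp add: stage_coord_def q_def algebra_simps)
  have recp: "itinerary_rec L n p" and recq: "itinerary_rec L n q"
    using itinerary_rec_diff[OF rec(2,1), of "max_ratio s" 1]
      itinerary_rec_diff[OF rec(1,2), of 1 "min_ratio s"] by (simp_all add: p_def q_def)
  have nnp: "nonneg_stage L p s" unfolding nonneg_stage_iff
    using coord_ratio_bounds(2)[of _ s] stage_coord_pos[of _ s]
    by (auto simp: cp coord_ratio_def field_simps)
  have nnq: "nonneg_stage L q s" unfolding nonneg_stage_iff
    using coord_ratio_bounds(1)[of _ s] stage_coord_pos[of _ s]
    by (auto simp: cq coord_ratio_def field_simps)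
  obtain i where i: "i \<le> L" "min_ratio r = coord_ratio r i" by (rule min_ratio_attained)
  obtain j where j: "j \<le> L" "max_ratio r = coord_ratio r j" by (rule max_ratio_attained)
  note ij = i j
  define a b where "a = stage_coord L z r" and "b = stage_coord L z' r"
  have ab: "0 < a i" "0 < a j" "0 < b i" "0 < b j"
    using stage_coord_pos ij by (auto simp: a_def b_def)
  have a: "a i = min_ratio r * b i" "a j = max_ratio r * b j"
    using ab by (auto simp: ij coord_ratio_def a_def b_def)
  have "nonneg_stage L p r" "nonneg_stage L q r"
    by (rule nonneg_stage_antimono[OF recp L nnp] nonneg_stage_antimono[OF recq L nnq], simp add: s_def)+
  then have "0 \<le> stage_coord L q r i" "0 \<le> stage_coord L p r j"
    using ij unfolding nonneg_stage_iff by auto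
  then have le: "min_ratio s \<le> min_ratio r" "max_ratio r \<le> max_ratio s"
    using ab unfolding cp cq a_def[symmetric] b_def[symmetric] a by auto
  have "stage_coord L p r i * stage_coord L q r j \<le> E r * (stage_coord L p r j * stage_coord L q r i)"
    unfolding E_def using recp nnp recq nnq ij unfolding s_def by (intro stage_coord_cross_ratio) auto
  then have "(b i * b j) * ((max_ratio s - min_ratio r) * (max_ratio r - min_ratio s))
      \<le> (b i * b j) * (E r * ((max_ratio s - max_ratio r) * (min_ratio r - min_ratio s)))"
    unfolding cp cq a_def[symmetric] b_def[symmetric] a by (simp add: algebra_simps)
  then have "(max_ratio s - min_ratio r) * (max_ratio r - min_ratio s)
      \<le> E r * ((max_ratio s - max_ratio r) * (min_ratio r - min_ratio s))"
    using ab by simp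
  then show ?thesis
    using le min_ratio_pos[of s] min_le_max_ratio[of r] spread_ge_1[of r]
    unfolding s_def by (intro birkhoff_interval_contraction) (auto simp: E_def)
qed

lemma solutions_proportional:
  assumes growth: "\<And>r. r \<ge> 1 \<Longrightarrow> real (n r) \<le> C * (real r)\<^sup>2"
  shows "max_ratio 0 = min_ratio 0"
proof -
  define h where "h = (\<lambda>i. ln (max_ratio (2 * L * i) / min_ratio (2 * L * i)))"
  \<comment> \<open>Stages are sampled at multiples of \<open>2 * L\<close>, the step of
    \<open>ratio_contraction\<close>. Window indices are below \<open>2 * L * (i + 1)\<close>, whose
    square gives the \<open>4 * L^2\<close>; the absolute value avoids any assumption on the sign of
    \<open>C\<close>.\<close>
  define D where "D = 4 * (1 + real L * (1 + 4 * \<bar>C\<bar> * (real L)\<^sup>2))"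
  have D: "4 \<le> D" unfolding D_def by (simp add: mult_nonneg_nonneg add_nonneg_nonneg)
  have E_le: "4 * spread (2 * L * i) \<le> D * (real (i + 1))\<^sup>2" for i
  proof -
    have i1: "1 \<le> (real (i + 1))\<^sup>2" by (intro one_le_power) simp
    have "real (n (2 * L * i + L + j)) + 1 \<le> (1 + 4 * \<bar>C\<bar> * (real L)\<^sup>2) * (real (i + 1))\<^sup>2" if "j < L" for j
    proof -
      have "real (n (2 * L * i + L + j)) \<le> C * (real (2 * L * i + L + j))\<^sup>2"
        using L by (intro growth) auto
      also have "\<dots> \<le> \<bar>C\<bar> * (real (2 * L * i + L + j))\<^sup>2" by (intro mult_right_mono) auto
      also have "\<dots> \<le> \<bar>C\<bar> * (real (2 * L * (i + 1)))\<^sup>2"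
        using that by (intro mult_left_mono power_mono) (auto simp: algebra_simps)
      also have "\<dots> = 4 * \<bar>C\<bar> * (real L)\<^sup>2 * (real (i + 1))\<^sup>2"
        unfolding of_nat_mult power_mult_distrib by simp
      finally show ?thesis using i1 unfolding distrib_right mult_1 by linarith
    qed
    then have "(\<Sum>j<L. real (n (2 * L * i + L + j)) + 1) \<le> (\<Sum>j<L. (1 + 4 * \<bar>C\<bar> * (real L)\<^sup>2) * (real (i + 1))\<^sup>2)"
      by (intro sum_mono) auto
    then have "spread (2 * L * i) \<le> 1 * (real (i + 1))\<^sup>2 + real L * ((1 + 4 * \<bar>C\<bar> * (real L)\<^sup>2) * (real (i + 1))\<^sup>2)"
      using i1 unfolding spread_def sum_constant card_lessThan mult_1 by linarith
    also have "\<dots> = D / 4 * (real (i + 1))\<^sup>2" by (simp add: D_def algebra_simps)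
    finally show ?thesis by simp
  qed
  have h_nonneg: "0 \<le> h i" for i
    using min_le_max_ratio[of "2 * L * i"] min_ratio_pos[of "2 * L * i"] by (simp add: h_def)
  have "h 0 = 0"
  proof (rule slow_contraction_imp_zero[where c = "1 / sqrt D" and A = "ln D" and B = 2])
    show "0 < 1 / sqrt D" using D by simp
    show "0 \<le> h i" for i by (rule h_nonneg)
    show "h i \<le> ln D + 2 * ln (real (i + 1))" for i
    proof -
      have "max_ratio (2 * L * i) / min_ratio (2 * L * i) \<le> D * (real (i + 1))\<^sup>2"
        using cross_ratio_of_solutions E_le order_trans by blast
      then have "h i \<le> ln (D * (real (i + 1))\<^sup>2)"
        using min_ratio_pos[of "2 * L * i"] min_le_max_ratio[of "2 * L * i"] 
        unfolding h_def by (intro ln_mono) auto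
      also have "\<dots> = ln D + 2 * ln (real (i + 1))"
        using D by (subst ln_mult_pos) (auto simp: ln_realpow simp del: of_nat_add of_nat_Suc)
      finally show ?thesis .
    qed
    show "h i \<le> (1 - 1 / sqrt D / real (i + 1)) * h (Suc i)" for i
    proof -
      define y where "y = sqrt (4 * spread (2 * L * i))"
      have y1: "1 \<le> y" using spread_ge_1[of "2 * L * i"] by (simp add: y_def)
      have "y \<le> sqrt (D * (real (i + 1))\<^sup>2)" unfolding y_def using E_le by (intro real_sqrt_le_mono)
      then have yD: "y \<le> sqrt D * real (i + 1)" by (simp add: real_sqrt_mult)
      \<comment> \<open>This gives away part of the contraction but keeps a defect
        \<open>1 / y\<close> of order at least \<open>1 / (i + 1)\<close>.\<close>
      have "(y - 1) / (y + 1) \<le> 1 - 1 / y" using y1 by (simp add: field_simps)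
      also have "\<dots> \<le> 1 - 1 / (sqrt D * real (i + 1))"
        using yD y1 by (intro diff_left_mono divide_left_mono) auto
      finally have "(y - 1) / (y + 1) \<le> 1 - 1 / sqrt D / real (i + 1)" by simp
      moreover have "h i \<le> (y - 1) / (y + 1) * h (Suc i)"
        using ratio_contraction[of "2 * L * i"] unfolding h_def y_def by (simp add: algebra_simps)
      ultimately show ?thesis using mult_right_mono[OF _ h_nonneg[of "Suc i"]] order_trans by blast
    qed
  qed
  then have "ln (max_ratio 0 / min_ratio 0) = 0" by (simp add: h_def)
  then show ?thesis using min_ratio_pos[of 0] min_le_max_ratio[of 0] 
    by (subst (asm) ln_eq_zero_iff) (auto simp: field_simps)
qed

end

lemma solution_unique:
  assumes "itinerary_rec L n z" "itinerary_rec L n z'"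
    and "\<And>s. nonneg_stage L z s" "\<And>s. nonneg_stage L z' s"
    and "\<And>s. 0 < z s" "\<And>s. 0 < z' s"
    and growth: "\<And>r. r \<ge> 1 \<Longrightarrow> real (n r) \<le> C * (real r)\<^sup>2"
    and "z 0 = z' 0" "j \<le> L"
  shows "z j = z' j"
proof -
  note sol = assms(1-6)
  define \<rho> where "\<rho> = max_ratio z z' 0"
  have proportional: "stage_coord L z 0 i = \<rho> * stage_coord L z' 0 i" if "i \<le> L" for i
  proof -
    have "coord_ratio z z' 0 i = \<rho>"
      using coord_ratio_bounds[OF sol that, of 0] solutions_proportional[OF sol growth]
      by (auto simp: \<rho>_def)
    then show ?thesis
      using stage_coord_pos(2)[OF sol that, of 0] unfolding coord_ratio_def[OF sol] by (simp add: field_simps)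
  qed
  \<comment> \<open>Values are rebuilt from index \<open>L\<close> downwards: \<open>z L\<close> is
    the last coordinate, and each earlier value adds one drop.\<close>
  have *: "z (L - i) = \<rho> * z' (L - i)" if "i \<le> L" for i using that
  proof (induction i)
    case 0
    then show ?case using proportional[of L] by (simp add: stage_coord_def)
  next
    case (Suc i)
    then have "Suc (L - Suc i) = L - i" by simp
    then show ?case using proportional[of "L - Suc i"] Suc by (simp add: stage_coord_def algebra_simps)
  qed
  have "z 0 = \<rho> * z' 0" using *[of L] by simp
  then have "\<rho> = 1" using assms(8) assms(5)[of 0] by simp
  then show ?thesis using *[of "L - j"] assms(9) by simp
qed

end

lemma convergent_of_geometric_steps:
  fixes f :: "nat \<Rightarrow> 'a::banach"
  assumes "\<And>i. norm (f (Suc i) - f i) \<le> (1 / 2) ^ i"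
  shows "convergent f"
proof -
  have "summable (\<lambda>i. f (Suc i) - f i)"
    by (rule summable_comparison_test'[where g = "\<lambda>i. (1 / 2) ^ i" and N = 0])
       (use assms in \<open>auto intro: summable_geometric\<close>)
  then have "(\<lambda>m. \<Sum>i<m. f (Suc i) - f i) \<longlonglongrightarrow> (\<Sum>i. f (Suc i) - f i)"
    by (rule summable_LIMSEQ)
  then have "(\<lambda>m. f m - f 0) \<longlonglongrightarrow> (\<Sum>i. f (Suc i) - f i)"
    by (simp add: sum_lessThan_telescope)
  from tendsto_add[OF this tendsto_const[of "f 0"]] show ?thesis
    by (auto simp: convergent_def)
qed

section \<open>The unnormalised dynamics\<close>

locale itinerary_map =
  fixes k :: nat and e :: "nat \<Rightarrow> 'i::finite" and n :: "nat \<Rightarrow> nat"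
  assumes k_ge_2: "2 \<le> k" and numbering: "bij_betw e {1..k} (UNIV :: 'i set)"
begin

definition coord_sum :: "real ^ 'i \<Rightarrow> real" where
  "coord_sum x = (\<Sum>j=1..k. x $ e j)"

definition nonneg_vec :: "real ^ 'i \<Rightarrow> bool" where
  "nonneg_vec x \<longleftrightarrow> (\<forall>j\<in>{1..k}. 0 \<le> x $ e j)"

definition branch :: "nat \<Rightarrow> real ^ 'i \<Rightarrow> real ^ 'i" where
  "branch m x = (\<chi> i. let j = inv_into {1..k} e i in
     if j = k then (real m + 1) * x $ e k - x $ e 1
     else if j = k - 1 then x $ e 1 - real m * x $ e k
     else x $ e (j + 1))"

definition normalise :: "real ^ 'i \<Rightarrow> real ^ 'i" where
  "normalise x = (1 / coord_sum x) *\<^sub>R x"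

text \<open>The branch at step \<open>r\<close> is dictated by \<open>n\<close> and not chosen by
  \<open>J\<close>, which makes \<open>orbit r\<close> linear on the whole space.\<close>

primrec orbit :: "nat \<Rightarrow> real ^ 'i \<Rightarrow> real ^ 'i" where
  "orbit 0 x = x"
| "orbit (Suc r) x = branch (n r) (orbit r x)"

definition orbit_sum :: "real ^ 'i \<Rightarrow> nat \<Rightarrow> real" where
  "orbit_sum x r = coord_sum (orbit r x)"

lemma inj_numbering: "inj_on e {1..k}"
  using numbering by (rule bij_betw_imp_inj_on)

lemma vec_eq_numbering:
  assumes "\<And>j. j \<in> {1..k} \<Longrightarrow> x $ e j = y $ e j"
  shows "(x :: real ^ 'i) = y"
  unfolding vec_eq_iff
proof
  fix i
  have "i \<in> e ` {1..k}" using numbering by (simp add: bij_betw_def)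
  then show "x $ i = y $ i" using assms by auto
qed

lemma branch_nth:
  assumes "j \<in> {1..k}"
  shows "branch m x $ e j = (if j = k then (real m + 1) * x $ e k - x $ e 1
     else if j = k - 1 then x $ e 1 - real m * x $ e k else x $ e (Suc j))"
  using inv_into_f_f[OF inj_numbering assms] by (simp add: branch_def Let_def)

lemma K_branch_eq: "K_branch k e m x = (1 / (1 - x $ e 1)) *\<^sub>R branch m x"
  by (simp add: K_branch_def branch_def)

lemma linear_branch: "linear (branch m)"
  by (intro linearI vec_eq_numbering) (auto simp: branch_nth algebra_simps)

lemma linear_orbit: "linear (orbit r)"
proof (induction r)
  case (Suc r)
  then show ?case using linear_compose[OF Suc linear_branch] by (simp add: comp_def)
qed (simp add: linear_id[unfolded id_def])

lemma linear_coord_sum: "linear coord_sum"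
  by (intro linearI) (auto simp: coord_sum_def sum.distrib sum_distrib_left)

text \<open>The last two entries of \<open>branch m x\<close> add up to \<open>x $ e k\<close> and
  the others are shifted, so only \<open>x $ e 1\<close> is lost. This is the origin of the factor
  in \<open>K_branch\<close>.\<close>

lemma coord_sum_branch: "coord_sum (branch m x) = coord_sum x - x $ e 1"
proof -
  obtain p where p: "k = Suc (Suc p)" using k_ge_2 by (metis Suc_le_D numeral_2_eq_2 Suc_le_mono)
  have split: "(\<Sum>j=1..k. f j) = (\<Sum>j=1..p. f j) + f (Suc p) + f k" for f :: "nat \<Rightarrow> real"
    by (simp add: p)
  have shift: "(\<Sum>j=1..k. f j) = f 1 + (\<Sum>j=Suc 1..Suc p. f j) + f k" for f :: "nat \<Rightarrow> real"
    unfolding p by (simp add: sum.atLeast_Suc_atMost)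
  have "coord_sum (branch m x) = (\<Sum>j=1..p. branch m x $ e j) + branch m x $ e (Suc p) + branch m x $ e k"
    unfolding coord_sum_def by (rule split)
  also have "(\<Sum>j=1..p. branch m x $ e j) = (\<Sum>j=1..p. x $ e (Suc j))"
    by (intro sum.cong refl, subst branch_nth) (use p in auto)
  also have "branch m x $ e (Suc p) = x $ e 1 - real m * x $ e k"
    by (subst branch_nth) (auto simp: p)
  also have "branch m x $ e k = (real m + 1) * x $ e k - x $ e 1"
    by (subst branch_nth) (auto simp: p)
  finally have *: "coord_sum (branch m x) = (\<Sum>j=1..p. x $ e (Suc j)) + x $ e k"
    by (simp add: algebra_simps)
  have "coord_sum x = x $ e 1 + (\<Sum>j=Suc 1..Suc p. x $ e j) + x $ e k"
    unfolding coord_sum_def by (rule shift)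
  then show ?thesis using * unfolding sum.shift_bounds_cl_Suc_ivl by simp
qed

lemma branch_inj:
  assumes "branch m x = 0"
  shows "x = 0"
proof (rule vec_eq_numbering)
  have z: "branch m x $ e j = 0" for j using assms by simp
  have "(real m + 1) * x $ e k - x $ e 1 = 0" "x $ e 1 - real m * x $ e k = 0"
    using z[of k] z[of "k - 1"] k_ge_2 by (auto simp: branch_nth split: if_splits)
  then have k1: "x $ e k = 0" "x $ e 1 = 0" by (auto simp: algebra_simps)
  fix j assume j: "j \<in> {1..k}"
  show "x $ e j = 0 $ e j"
  proof (cases "j = 1 \<or> j = k")
    case False
    then have "j - 1 \<in> {1..k}" "j - 1 \<noteq> k" "j - 1 \<noteq> k - 1" "Suc (j - 1) = j" using j by auto
    then show ?thesis using z[of "j - 1"] by (simp add: branch_nth)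
  qed (use k1 in auto)
qed

lemma orbit_inj: "orbit r x = 0 \<Longrightarrow> x = 0"
  by (induction r) (use branch_inj in auto)

lemma coord_sum_eq_UNIV: "coord_sum x = (\<Sum>i\<in>UNIV. x $ i)"
  unfolding coord_sum_def by (rule sum.reindex_bij_betw[OF numbering])

lemma nonneg_vec_nth: "nonneg_vec x \<Longrightarrow> 0 \<le> x $ i"
proof -
  assume x: "nonneg_vec x"
  have "i \<in> e ` {1..k}" using numbering by (simp add: bij_betw_def)
  then show ?thesis using x by (auto simp: nonneg_vec_def)
qed

lemma coord_sum_nonneg: "nonneg_vec x \<Longrightarrow> 0 \<le> coord_sum x"
  unfolding coord_sum_def nonneg_vec_def by (intro sum_nonneg) blast

lemma norm_le_coord_sum: "nonneg_vec x \<Longrightarrow> norm x \<le> coord_sum x"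
  using norm_le_l1_cart[of x] nonneg_vec_nth[of x] by (simp add: coord_sum_eq_UNIV)

lemma nth_le_coord_sum:
  assumes "nonneg_vec x" "j \<in> {1..k}"
  shows "x $ e j \<le> coord_sum x"
  unfolding coord_sum_def
  using member_le_sum[of j "{1..k}" "\<lambda>j. x $ e j"] assms by (auto simp: nonneg_vec_def)

lemma coord_sum_pos:
  assumes "nonneg_vec x" "0 < x $ e k"
  shows "0 < coord_sum x"
  using nth_le_coord_sum[OF assms(1), of k] assms(2) k_ge_2 by simp

lemma Delta_iff: "x \<in> Delta k e \<longleftrightarrow> nonneg_vec x \<and> 0 < x $ e k \<and> coord_sum x = 1"
  by (simp add: Delta_def nonneg_vec_def coord_sum_def)

section \<open>The fibre in terms of the linear iterates\<close>

lemma J_normalise: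
  assumes "nonneg_vec x" "0 < x $ e k"
  shows "J k e (normalise x) = J k e x"
  using coord_sum_pos[OF assms] by (simp add: J_def normalise_def)

text \<open>Only the last two entries can fail, and their signs say
  \<open>m \<le> x $ e 1 / x $ e k < m + 1\<close>.\<close>

lemma branch_valid_iff:
  assumes "nonneg_vec x" "0 < x $ e k"
  shows "nonneg_vec (branch m x) \<and> 0 < branch m x $ e k \<longleftrightarrow> J k e x = m"
proof -
  have "nonneg_vec (branch m x) \<and> 0 < branch m x $ e k
      \<longleftrightarrow> real m * x $ e k \<le> x $ e 1 \<and> x $ e 1 < (real m + 1) * x $ e k"
  proof
    assume a: "nonneg_vec (branch m x) \<and> 0 < branch m x $ e k"
    then have "0 \<le> branch m x $ e (k - 1)" "0 < branch m x $ e k"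
      using k_ge_2 by (auto simp: nonneg_vec_def)
    then show "real m * x $ e k \<le> x $ e 1 \<and> x $ e 1 < (real m + 1) * x $ e k"
      using k_ge_2 by (auto simp: branch_nth split: if_splits)
  next
    assume a: "real m * x $ e k \<le> x $ e 1 \<and> x $ e 1 < (real m + 1) * x $ e k"
    then have "0 \<le> branch m x $ e j" if "j \<in> {1..k}" for j
      using assms that by (auto simp: branch_nth nonneg_vec_def)
    moreover have "0 < branch m x $ e k" using a k_ge_2 by (simp add: branch_nth)
    ultimately show "nonneg_vec (branch m x) \<and> 0 < branch m x $ e k" by (simp add: nonneg_vec_def)
  qed
  also have "\<dots> \<longleftrightarrow> real m \<le> x $ e 1 / x $ e k \<and> x $ e 1 / x $ e k < real m + 1"
    using assms(2) by (simp add: field_simps)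
  also have "\<dots> \<longleftrightarrow> \<lfloor>x $ e 1 / x $ e k\<rfloor> = int m" by (simp add: floor_eq_iff)
  also have "\<dots> \<longleftrightarrow> J k e x = m"
  proof -
    have "0 \<le> \<lfloor>x $ e 1 / x $ e k\<rfloor>" using assms k_ge_2 by (auto simp: nonneg_vec_def)
    then show ?thesis unfolding J_def by linarith
  qed
  finally show ?thesis .
qed

lemma K_normalise:
  assumes "nonneg_vec x" "0 < x $ e k"
  shows "K k e (normalise x) = normalise (branch (J k e x) x)"
proof -
  have pos: "0 < coord_sum x" by (rule coord_sum_pos[OF assms])
  have "K k e (normalise x) = (1 / (1 - x $ e 1 / coord_sum x) * (1 / coord_sum x)) *\<^sub>R branch (J k e x) x"
    unfolding K_def K_branch_eq J_normalise[OF assms]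
    by (simp add: normalise_def linear_cmul[OF linear_branch])
  also have "1 / (1 - x $ e 1 / coord_sum x) * (1 / coord_sum x) = 1 / (coord_sum x - x $ e 1)"
    using pos by (simp add: field_simps)
  finally show ?thesis by (simp add: normalise_def coord_sum_branch)
qed

text \<open>\<open>J\<close> agrees with \<open>n\<close> at a step exactly when the next linear
  iterate stays in the cone, and then the orbit under \<open>K\<close> is the normalised linear
  orbit.\<close>

lemma Phi_fibre_iff_valid:
  "x \<in> Phi_fibre k e n \<longleftrightarrow> coord_sum x = 1 \<and> (\<forall>r. nonneg_vec (orbit r x) \<and> 0 < orbit r x $ e k)"
proof
  assume "x \<in> Phi_fibre k e n"
  then have x: "x \<in> Delta k e" and Phi: "\<And>r. J k e ((K k e ^^ r) x) = n r"
    by (auto simp: Phi_fibre_def Phi_def[symmetric])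
  have "(K k e ^^ r) x = normalise (orbit r x) \<and> nonneg_vec (orbit r x) \<and> 0 < orbit r x $ e k" for r
  proof (induction r)
    case 0
    then show ?case using x by (simp add: Delta_iff normalise_def)
  next
    case (Suc r)
    have "J k e (orbit r x) = n r" using Phi[of r] Suc J_normalise by metis
    then show ?case using Suc branch_valid_iff K_normalise by simp
  qed
  then show "coord_sum x = 1 \<and> (\<forall>r. nonneg_vec (orbit r x) \<and> 0 < orbit r x $ e k)"
    using x by (simp add: Delta_iff)
next
  assume x: "coord_sum x = 1 \<and> (\<forall>r. nonneg_vec (orbit r x) \<and> 0 < orbit r x $ e k)"
  have J: "J k e (orbit r x) = n r" for r
    using x branch_valid_iff[of "orbit r x" "n r"] by (metis orbit.simps(2))
  have K: "(K k e ^^ r) x = normalise (orbit r x)" for r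
  proof (induction r)
    case 0
    then show ?case using x by (simp add: normalise_def)
  next
    case (Suc r)
    then show ?case using x K_normalise[of "orbit r x"] J by simp
  qed
  have "Phi k e x r = n r" for r
    unfolding Phi_def K using x J J_normalise by simp
  moreover have "x \<in> Delta k e" using x by (auto simp: Delta_iff dest: spec[of _ 0])
  ultimately show "x \<in> Phi_fibre k e n" by (auto simp: Phi_fibre_def)
qed

text \<open>Coordinate \<open>j\<close> only shifts until it is the first coordinate of iterate
  \<open>r + (j - 1)\<close>; the next step removes it from the coordinate sum.\<close>

lemma orbit_nth_less:
  assumes "1 \<le> j" "j < k"
  shows "orbit r x $ e j = orbit_sum x (r + (j - 1)) - orbit_sum x (r + j)"
  using assms
proof (induction j arbitrary: r rule: nat_induct_at_least)
  case base
  then show ?case by (simp add: orbit_sum_def coord_sum_branch)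
next
  case (Suc j)
  then have "orbit r x $ e (Suc j) = orbit (Suc r) x $ e j" by (simp add: branch_nth)
  moreover have "orbit (Suc r) x $ e j = orbit_sum x (Suc r + (j - 1)) - orbit_sum x (Suc r + j)"
    by (rule Suc.IH) (use Suc.prems in simp)
  ultimately show ?case using Suc.hyps by (simp del: orbit.simps)
qed

lemma orbit_nth_last: "orbit r x $ e k = orbit_sum x (r + (k - 1))"
proof -
  have "(\<Sum>j=1..m. orbit r x $ e j) = orbit_sum x r - orbit_sum x (r + m)" if "m < k" for m
    using that by (induction m) (auto simp: orbit_nth_less)
  from this[of "k - 1"] have "(\<Sum>j=1..k - 1. orbit r x $ e j) = orbit_sum x r - orbit_sum x (r + (k - 1))"
    using k_ge_2 by simp
  moreover have "coord_sum (orbit r x) = (\<Sum>j=1..k - 1. orbit r x $ e j) + orbit r x $ e k"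
  proof -
    have "(\<Sum>j=1..k. f j) = (\<Sum>j=1..k - 1. f j) + f k" for f :: "nat \<Rightarrow> real"
      using k_ge_2 by (cases k) auto
    then show ?thesis by (simp only: coord_sum_def)
  qed
  ultimately show ?thesis by (simp add: orbit_sum_def)
qed

lemma stage_coord_orbit_sum:
  assumes "j \<le> k - 1"
  shows "stage_coord (k - 1) (orbit_sum x) r j = orbit r x $ e (Suc j)"
proof (cases "j < k - 1")
  case True
  then show ?thesis by (simp add: stage_coord_def orbit_nth_less)
next
  case False
  then have "Suc j = k" using assms k_ge_2 by simp
  then show ?thesis using False by (simp add: stage_coord_def orbit_nth_last)
qed

text \<open>Entry \<open>k - 1\<close> of iterate \<open>Suc r\<close> is computed twice, from the
  branch and as a difference of coordinate sums.\<close>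

lemma itinerary_rec_orbit_sum: "itinerary_rec (k - 1) n (orbit_sum x)"
  unfolding itinerary_rec_def
proof
  fix r
  have "orbit (Suc r) x $ e (k - 1) = orbit r x $ e 1 - real (n r) * orbit r x $ e k"
    unfolding orbit.simps by (subst branch_nth) (use k_ge_2 in auto)
  moreover have "orbit (Suc r) x $ e (k - 1) = orbit_sum x (r + (k - 1)) - orbit_sum x (Suc (r + (k - 1)))"
  proof -
    have "Suc r + (k - 1 - 1) = r + (k - 1)" "Suc r + (k - 1) = Suc (r + (k - 1))" using k_ge_2 by auto
    then show ?thesis using orbit_nth_less[of "k - 1" "Suc r" x] k_ge_2 by simp
  qed
  moreover have "orbit r x $ e 1 = orbit_sum x r - orbit_sum x (Suc r)"
    using orbit_nth_less[of 1 r x] k_ge_2 by simp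
  ultimately show "orbit_sum x r - orbit_sum x (Suc r) = real (n r) * orbit_sum x (r + (k - 1))
      + (orbit_sum x (r + (k - 1)) - orbit_sum x (Suc (r + (k - 1))))"
    by (simp only: orbit_nth_last)
qed

lemma fibre_orbit_sum:
  assumes "x \<in> Phi_fibre k e n"
  shows "nonneg_stage (k - 1) (orbit_sum x) s" "0 < orbit_sum x s" "orbit_sum x 0 = 1"
proof -
  have x: "coord_sum x = 1" "\<And>r. nonneg_vec (orbit r x)" "\<And>r. 0 < orbit r x $ e k"
    using assms by (auto simp: Phi_fibre_iff_valid)
  show "nonneg_stage (k - 1) (orbit_sum x) s"
    unfolding nonneg_stage_iff
  proof (intro allI impI)
    fix j assume j: "j \<le> k - 1"
    then have "Suc j \<in> {1..k}" using k_ge_2 by auto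
    then show "0 \<le> stage_coord (k - 1) (orbit_sum x) s j"
      using x(2)[of s] unfolding stage_coord_orbit_sum[OF j] nonneg_vec_def by blast
  qed
  show "0 < orbit_sum x s" unfolding orbit_sum_def by (rule coord_sum_pos[OF x(2,3)])
  show "orbit_sum x 0 = 1" using x by (simp add: orbit_sum_def)
qed

lemma fibre_unique:
  assumes "\<And>r. 0 < n r" "\<And>r. r \<ge> 1 \<Longrightarrow> real (n r) \<le> C * (real r)\<^sup>2"
    "x \<in> Phi_fibre k e n" "y \<in> Phi_fibre k e n"
  shows "x = y"
proof (rule vec_eq_numbering)
  have L: "1 \<le> k - 1" using k_ge_2 by simp
  have eq: "orbit_sum x j = orbit_sum y j" if "j \<le> k - 1" for j
    using solution_unique[OF L assms(1) itinerary_rec_orbit_sum itinerary_rec_orbit_sum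
        fibre_orbit_sum(1)[OF assms(3)] fibre_orbit_sum(1)[OF assms(4)]
        fibre_orbit_sum(2)[OF assms(3)] fibre_orbit_sum(2)[OF assms(4)] assms(2) _ that]
      fibre_orbit_sum(3)[OF assms(3)] fibre_orbit_sum(3)[OF assms(4)] by simp
  fix j assume j: "j \<in> {1..k}"
  show "x $ e j = y $ e j"
  proof (cases "j = k")
    case True
    then show ?thesis using orbit_nth_last[of 0 x] orbit_nth_last[of 0 y] eq by simp
  next
    case False
    then show ?thesis using orbit_nth_less[of j 0 x] orbit_nth_less[of j 0 y] eq j by simp
  qed
qed

section \<open>Inverse products and their columns\<close>

definition basis_vec :: "nat \<Rightarrow> real ^ 'i" where
  "basis_vec j = axis (e (Suc j)) 1"

text \<open>In the notation of the introduction, \<open>column s j\<close> is \<open>v (s + j)\<close> for \<open>j < L\<close> and \<open>column s L\<close> is \<open>u s\<close>.\<close>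

primrec column :: "nat \<Rightarrow> nat \<Rightarrow> real ^ 'i" where
  "column 0 = (\<lambda>j. basis_vec j)"
| "column (Suc s) = (\<lambda>j. if Suc j < k - 1 then column s (Suc j)
     else (if Suc j = k then real (n s) else real (n s) + 1) *\<^sub>R column s 0 + column s (k - 1))"

lemma column_Suc_cases:
  assumes "j < k"
  obtains "Suc j < k - 1" "column (Suc s) j = column s (Suc j)"
  | c where "real (n s) \<le> c" "c \<le> real (n s) + 1" "column (Suc s) j = c *\<^sub>R column s 0 + column s (k - 1)"
proof (cases "Suc j < k - 1")
  case False
  then have "column (Suc s) j
      = (if Suc j = k then real (n s) else real (n s) + 1) *\<^sub>R column s 0 + column s (k - 1)"
    by simp
  then show ?thesis by (rule that(2)[rotated 2]) auto
qed (use that in simp)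

lemma basis_vec_nth:
  assumes "j < k" "i \<in> {1..k}"
  shows "basis_vec j $ e i = (if i = Suc j then 1 else 0)"
  using inj_onD[OF inj_numbering, of i "Suc j"] assms by (auto simp: basis_vec_def axis_def)

lemma nonneg_basis_vec: "nonneg_vec (basis_vec j)"
  by (simp add: nonneg_vec_def basis_vec_def axis_def)

lemma basis_expansion: "x = (\<Sum>j<k. x $ e (Suc j) *\<^sub>R basis_vec j)"
proof (rule vec_eq_numbering)
  fix i assume i: "i \<in> {1..k}"
  have "(\<Sum>j<k. x $ e (Suc j) *\<^sub>R basis_vec j) $ e i = (\<Sum>j<k. if j = i - 1 then x $ e (Suc j) else 0)"
    unfolding sum_component by (intro sum.cong refl) (use i in \<open>auto simp: basis_vec_nth\<close>)
  also have "\<dots> = x $ e i" using i by (subst sum.delta) auto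
  finally show "x $ e i = (\<Sum>j<k. x $ e (Suc j) *\<^sub>R basis_vec j) $ e i" by simp
qed

lemma branch_basis_vec:
  assumes "Suc j < k - 1"
  shows "branch m (basis_vec (Suc j)) = basis_vec j"
  by (rule vec_eq_numbering) (use assms in \<open>auto simp: branch_nth basis_vec_nth\<close>)

text \<open>For \<open>c = m + 1\<close> and \<open>c = m\<close> this yields the preimages of
  \<open>basis_vec (k - 2)\<close> and \<open>basis_vec (k - 1)\<close>, hence the two coefficients
  in \<open>column\<close>.\<close>

lemma branch_last_pair:
  "branch m (c *\<^sub>R basis_vec 0 + basis_vec (k - 1))
    = (c - real m) *\<^sub>R basis_vec (k - 2) + (real m + 1 - c) *\<^sub>R basis_vec (k - 1)"
  by (rule vec_eq_numbering) (use k_ge_2 in \<open>auto simp: branch_nth basis_vec_nth\<close>)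

lemma orbit_column: "j < k \<Longrightarrow> orbit r (column r j) = basis_vec j"
proof (induction r arbitrary: j)
  case (Suc r)
  show ?case
  proof (cases "Suc j < k - 1")
    case True
    then have "orbit r (column r (Suc j)) = basis_vec (Suc j)" using Suc.IH by simp
    then show ?thesis using True branch_basis_vec by simp
  next
    case False
    have *: "orbit r (c *\<^sub>R column r 0 + column r (k - 1)) = c *\<^sub>R basis_vec 0 + basis_vec (k - 1)" for c
      using Suc.IH[of 0] Suc.IH[of "k - 1"] k_ge_2
      by (simp add: linear_add[OF linear_orbit] linear_cmul[OF linear_orbit])
    consider "Suc j = k" | "j = k - 2" "Suc j \<noteq> k" using False Suc.prems by linarith
    then show ?thesis
    proof cases
      case 1
      then have "column (Suc r) j = real (n r) *\<^sub>R column r 0 + column r (k - 1)" "j = k - 1" by auto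
      then show ?thesis by (simp add: * branch_last_pair del: column.simps One_nat_def)
    next
      case 2
      then have "column (Suc r) j = (real (n r) + 1) *\<^sub>R column r 0 + column r (k - 1)" using False by auto
      then show ?thesis using 2(1) by (simp add: * branch_last_pair del: column.simps One_nat_def)
    qed
  qed
qed simp

text \<open>Both sides have the same image under \<open>orbit s\<close>, which is injective. A
  vector with nonnegative \<open>s\<close>-th iterate is thus a nonnegative combination of the
  columns.\<close>

lemma column_expansion: "x = (\<Sum>j<k. orbit s x $ e (Suc j) *\<^sub>R column s j)"
proof -
  let ?y = "\<Sum>j<k. orbit s x $ e (Suc j) *\<^sub>R column s j"
  have "orbit s ?y = (\<Sum>j<k. orbit s (orbit s x $ e (Suc j) *\<^sub>R column s j))"
    by (rule linear_sum[OF linear_orbit])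
  also have "\<dots> = (\<Sum>j<k. orbit s x $ e (Suc j) *\<^sub>R basis_vec j)"
    by (intro sum.cong refl) (simp add: linear_cmul[OF linear_orbit] orbit_column)
  also have "\<dots> = orbit s x" by (rule basis_expansion[symmetric])
  finally have "orbit s (x - ?y) = 0" by (simp add: linear_diff[OF linear_orbit])
  then have "x - ?y = 0" by (rule orbit_inj)
  then show ?thesis by simp
qed

lemma nonneg_vec_add: "nonneg_vec x \<Longrightarrow> nonneg_vec y \<Longrightarrow> nonneg_vec (x + y)"
  by (simp add: nonneg_vec_def)

lemma nonneg_vec_scaleR: "0 \<le> c \<Longrightarrow> nonneg_vec x \<Longrightarrow> nonneg_vec (c *\<^sub>R x)"
  by (simp add: nonneg_vec_def)

text \<open>New columns combine old ones with nonnegative coefficients. For fixed \<open>r\<close>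
  and growing \<open>s\<close>, this keeps limits of columns in the cone of stage
  \<open>r\<close>.\<close>

lemma nonneg_orbit_column:
  assumes "r \<le> s"
  shows "j < k \<Longrightarrow> nonneg_vec (orbit r (column s j))"
  using assms
proof (induction s arbitrary: j rule: dec_induct)
  case base
  then show ?case by (simp add: orbit_column nonneg_basis_vec)
next
  case (step s)
  show ?case
  proof (rule column_Suc_cases[OF step.prems, of s])
    assume "Suc j < k - 1" "column (Suc s) j = column s (Suc j)"
    then show ?thesis using step.IH[of "Suc j"] by simp
  next
    fix c assume c: "real (n s) \<le> c" "column (Suc s) j = c *\<^sub>R column s 0 + column s (k - 1)"
    then have "0 \<le> c" using of_nat_0_le_iff order_trans by blast
    then show ?thesis using step.IH[of 0] step.IH[of "k - 1"] k_ge_2 c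
      by (simp add: linear_add[OF linear_orbit] linear_cmul[OF linear_orbit] nonneg_vec_add nonneg_vec_scaleR)
  qed
qed

lemma nonneg_column: "j < k \<Longrightarrow> nonneg_vec (column s j)"
  using nonneg_orbit_column[of 0 s j] by simp

lemma coord_sum_basis_vec: "j < k \<Longrightarrow> coord_sum (basis_vec j) = 1"
proof -
  assume j: "j < k"
  have "coord_sum (basis_vec j) = (\<Sum>i=1..k. if i = Suc j then 1 else 0)"
    unfolding coord_sum_def by (intro sum.cong refl) (use j basis_vec_nth in auto)
  also have "\<dots> = 1" using j by (subst sum.delta) auto
  finally show ?thesis .
qed

text \<open>A new combined column is one column plus at most \<open>n s + 1\<close> times another,
  so sums grow by a factor of at most \<open>n s + 2\<close>. The resulting product is the one in
  the growth hypothesis.\<close>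

lemma coord_sum_column_bounds:
  assumes "j < k"
  shows "1 \<le> coord_sum (column s j) \<and> coord_sum (column s j) \<le> (\<Prod>i=0..<s. real (n i) + 2)"
  using assms
proof (induction s arbitrary: j)
  case 0
  then show ?case by (simp add: coord_sum_basis_vec)
next
  case (Suc s)
  let ?P = "\<Prod>i=0..<s. real (n i) + 2"
  have P: "(\<Prod>i=0..<Suc s. real (n i) + 2) = (real (n s) + 1) * ?P + ?P" by (simp add: algebra_simps)
  have b: "1 \<le> coord_sum (column s 0)" "coord_sum (column s 0) \<le> ?P"
    "1 \<le> coord_sum (column s (k - 1))" "coord_sum (column s (k - 1)) \<le> ?P"
    using Suc.IH[of 0] Suc.IH[of "k - 1"] k_ge_2 by auto
  show ?case
  proof (rule column_Suc_cases[OF Suc.prems, of s])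
    assume a: "Suc j < k - 1" "column (Suc s) j = column s (Suc j)"
    have "0 \<le> (real (n s) + 1) * ?P" using b by simp
    moreover have "1 \<le> coord_sum (column s (Suc j)) \<and> coord_sum (column s (Suc j)) \<le> ?P"
      using Suc.IH[of "Suc j"] a(1) by simp
    ultimately show ?thesis unfolding P a(2) by linarith
  next
    fix c assume c: "real (n s) \<le> c" "c \<le> real (n s) + 1" "column (Suc s) j = c *\<^sub>R column s 0 + column s (k - 1)"
    have "0 \<le> c" using c(1) of_nat_0_le_iff order_trans by blast
    then have "0 \<le> c * coord_sum (column s 0)" "c * coord_sum (column s 0) \<le> (real (n s) + 1) * ?P"
      using b c by (auto intro!: mult_mono)
    then show ?thesis using b unfolding P c(3)
      by (simp add: linear_add[OF linear_coord_sum] linear_cmul[OF linear_coord_sum])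
  qed
qed

lemma coord_sum_normalise: "coord_sum x \<noteq> 0 \<Longrightarrow> coord_sum (normalise x) = 1"
  by (simp add: normalise_def linear_cmul[OF linear_coord_sum])

lemma nonneg_normalise: "nonneg_vec x \<Longrightarrow> nonneg_vec (normalise x)"
  unfolding normalise_def by (intro nonneg_vec_scaleR) (simp_all add: coord_sum_nonneg)

lemma norm_normalise_le_1: "nonneg_vec x \<Longrightarrow> coord_sum x \<noteq> 0 \<Longrightarrow> norm (normalise x) \<le> 1"
  using norm_le_coord_sum[OF nonneg_normalise] coord_sum_normalise by metis

text \<open>The normalised sum lies on the segment between \<open>normalise x\<close> and
  \<open>normalise y\<close>, with weight \<open>w\<close> on the latter, and the distance of these
  two ends is at most 2.\<close>

lemma normalise_near_dominant:
  assumes "nonneg_vec x" "nonneg_vec y" "0 < coord_sum x" "0 < coord_sum y" "0 < c"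
  shows "norm (normalise (c *\<^sub>R x + y) - normalise x) \<le> 2 * coord_sum y / (c * coord_sum x)"
proof -
  let ?X = "coord_sum x" and ?Y = "coord_sum y"
  define w where "w = ?Y / (c * ?X + ?Y)"
  have d: "0 < c * ?X + ?Y" using assms by (simp add: add_pos_pos)
  have w: "0 \<le> w" "w \<le> ?Y / (c * ?X)"
    using assms d by (auto simp: w_def intro!: divide_left_mono)
  have "normalise (c *\<^sub>R x + y) = (c / (c * ?X + ?Y)) *\<^sub>R x + (1 / (c * ?X + ?Y)) *\<^sub>R y"
    by (simp add: normalise_def linear_add[OF linear_coord_sum] linear_cmul[OF linear_coord_sum] scaleR_add_right)
  also have "(c / (c * ?X + ?Y)) = (1 - w) * (1 / ?X)" using assms d by (simp add: w_def field_simps)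
  also have "1 / (c * ?X + ?Y) = w * (1 / ?Y)" using assms d by (simp add: w_def field_simps)
  also have "((1 - w) * (1 / ?X)) *\<^sub>R x + (w * (1 / ?Y)) *\<^sub>R y
      = (1 - w) *\<^sub>R normalise x + w *\<^sub>R normalise y"
    unfolding normalise_def by (simp only: scaleR_scaleR)
  finally have "normalise (c *\<^sub>R x + y) - normalise x = w *\<^sub>R (normalise y - normalise x)"
    by (simp add: algebra_simps)
  then have "norm (normalise (c *\<^sub>R x + y) - normalise x) = w * norm (normalise y - normalise x)"
    using w by simp
  also have "\<dots> \<le> w * (1 + 1)"
    using w assms norm_triangle_ineq4[of "normalise y" "normalise x"] norm_normalise_le_1[of x] norm_normalise_le_1[of y]
    by (intro mult_left_mono) auto
  also have "\<dots> \<le> 2 * (?Y / (c * ?X))" using w by simp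
  finally show ?thesis by simp
qed

text \<open>Strict positivity is automatic: if the last coordinate vanished at stage
  \<open>r\<close>, so would the coordinate sum at stage \<open>r + (k - 1)\<close>, hence that
  iterate, hence \<open>x\<close>. Only closed linear conditions remain.\<close>

lemma fibre_eq: "Phi_fibre k e n = {x. coord_sum x = 1 \<and> (\<forall>r. nonneg_vec (orbit r x))}"
proof (intro set_eqI iffI)
  fix x assume "x \<in> {x. coord_sum x = 1 \<and> (\<forall>r. nonneg_vec (orbit r x))}"
  then have x: "coord_sum x = 1" "\<And>r. nonneg_vec (orbit r x)" by auto
  have "orbit r x $ e k \<noteq> 0" for r
  proof
    assume "orbit r x $ e k = 0"
    then have "coord_sum (orbit (r + (k - 1)) x) = 0" by (simp add: orbit_nth_last orbit_sum_def)
    then have "norm (orbit (r + (k - 1)) x) \<le> 0" using norm_le_coord_sum[OF x(2)] by metis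
    then have "x = 0" using orbit_inj by auto
    then show False using x(1) linear_0[OF linear_coord_sum] by simp
  qed
  moreover have "0 \<le> orbit r x $ e k" for r using x(2)[of r] k_ge_2 by (auto simp: nonneg_vec_def)
  ultimately show "x \<in> Phi_fibre k e n" using x by (simp add: Phi_fibre_iff_valid less_le)
qed (auto simp: Phi_fibre_iff_valid)

lemma convex_fibre: "convex (Phi_fibre k e n)"
  unfolding fibre_eq
  by (intro convexI) (auto simp: linear_add[OF linear_orbit] linear_cmul[OF linear_orbit]
      linear_add[OF linear_coord_sum] linear_cmul[OF linear_coord_sum] nonneg_vec_add nonneg_vec_scaleR)

lemma column_shift: "j < k - 1 \<Longrightarrow> column s j = column (s + j) 0"
proof (induction j arbitrary: s)
  case (Suc j)
  then have "column s (Suc j) = column (Suc s) j" by simp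
  then show ?case using Suc.IH[of "Suc s"] Suc.prems by simp
qed simp

lemma column_period:
  "column (s + (k - 1)) 0 = (real (n s) + 1) *\<^sub>R column s 0 + column s (k - 1)"
proof -
  have "\<not> Suc (k - 2) < k - 1" "Suc (k - 2) \<noteq> k" using k_ge_2 by auto
  then have "column (Suc s) (k - 2) = (real (n s) + 1) *\<^sub>R column s 0 + column s (k - 1)" by simp
  moreover have "column (Suc s) (k - 2) = column (Suc s + (k - 2)) 0"
    using k_ge_2 by (intro column_shift) auto
  moreover have "Suc s + (k - 2) = s + (k - 1)" using k_ge_2 by auto
  ultimately show ?thesis by metis
qed

lemma column_last_Suc: "column (Suc s) (k - 1) = real (n s) *\<^sub>R column s 0 + column s (k - 1)"
proof -
  have "\<not> Suc (k - 1) < k - 1" "Suc (k - 1) = k" using k_ge_2 by auto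
  then show ?thesis by (simp only: column.simps if_False if_True simp_thms)
qed

section \<open>Itineraries of rapid growth\<close>

text \<open>The offset \<open>k - 1\<close> avoids the index 0, about which the growth hypothesis
  says nothing.\<close>

definition cluster :: "nat \<Rightarrow> nat \<Rightarrow> real ^ 'i" where
  "cluster j i = normalise (column ((k - 1) + j + i * (k - 1)) 0)"

definition vertex :: "nat \<Rightarrow> real ^ 'i" where
  "vertex j = lim (cluster j)"

text \<open>The margin in row \<open>j\<close> of diagonal dominance, over the coordinates \<open>1, \<dots>, k - 1\<close> only.\<close>

definition dominance :: "nat \<Rightarrow> real ^ 'i \<Rightarrow> real" where
  "dominance j x = 2 * x $ e (Suc j) + x $ e k - coord_sum x"

lemma linear_dominance: "linear (dominance j)"
  by (intro linearI)
     (simp_all add: dominance_def linear_add[OF linear_coord_sum] linear_cmul[OF linear_coord_sum] algebra_simps)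

lemma dominance_ge: "nonneg_vec x \<Longrightarrow> Suc j \<le> k \<Longrightarrow> - coord_sum x \<le> dominance j x"
  using k_ge_2 unfolding dominance_def nonneg_vec_def by force

lemma nonneg_vec_tendsto:
  assumes "f \<longlonglongrightarrow> x" "eventually (\<lambda>i. nonneg_vec (f i)) sequentially"
  shows "nonneg_vec x"
  unfolding nonneg_vec_def
proof
  fix j assume j: "j \<in> {1..k}"
  have "(\<lambda>i. f i $ e j) \<longlonglongrightarrow> x $ e j" by (intro tendsto_intros assms(1))
  then show "0 \<le> x $ e j"
    by (rule tendsto_lowerbound) (use assms(2) j in \<open>auto simp: nonneg_vec_def elim: eventually_mono\<close>)
qed

context
  assumes k_ge_3: "3 \<le> k"
    and growth: "\<And>r. r \<ge> 1 \<Longrightarrow> n r \<ge> 2 ^ (r + 2) * (\<Prod>i=0..<r. (n i + 2))"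
begin

lemma last_column_small:
  assumes "1 \<le> s"
  shows "2 * coord_sum (column s (k - 1)) \<le> (1 / 2) ^ (s + 1) * real (n s)" "0 < n s"
proof -
  let ?P = "\<Prod>i=0..<s. real (n i) + 2"
  have "real (2 ^ (s + 2) * (\<Prod>i=0..<s. (n i + 2))) \<le> real (n s)"
    using growth[OF assms] by (simp only: of_nat_le_iff)
  then have n: "2 ^ (s + 2) * ?P \<le> real (n s)" by (simp add: add.commute)
  have P: "1 \<le> coord_sum (column s (k - 1)) \<and> coord_sum (column s (k - 1)) \<le> ?P"
    using k_ge_2 by (intro coord_sum_column_bounds) auto
  then have "0 < 2 ^ (s + 2) * ?P" by simp
  then show "0 < n s" using n by simp
  have "2 * coord_sum (column s (k - 1)) \<le> 2 * ?P" using P by simp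
  also have "\<dots> = (1 / 2) ^ (s + 1) * (2 ^ (s + 2) * ?P)" by (simp add: power_divide)
  also have "\<dots> \<le> (1 / 2) ^ (s + 1) * real (n s)" using n by (intro mult_left_mono) auto
  finally show "2 * coord_sum (column s (k - 1)) \<le> (1 / 2) ^ (s + 1) * real (n s)" .
qed

text \<open>A free \<open>c\<close> serves both uses: \<open>n s + 1\<close> along a residue class
  and \<open>n s\<close> for the last column.\<close>

lemma normalise_step:
  assumes "1 \<le> s" "real (n s) \<le> c"
  shows "norm (normalise (c *\<^sub>R column s 0 + column s (k - 1)) - normalise (column s 0)) \<le> (1 / 2) ^ (s + 1)"
proof -
  let ?X = "coord_sum (column s 0)" and ?Y = "coord_sum (column s (k - 1))"
  have b: "1 \<le> ?X" "1 \<le> ?Y" "nonneg_vec (column s 0)" "nonneg_vec (column s (k - 1))"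
    using coord_sum_column_bounds[of 0 s] coord_sum_column_bounds[of "k - 1" s]
      nonneg_column[of 0 s] nonneg_column[of "k - 1" s] k_ge_2 by auto
  have n: "0 < real (n s)" using last_column_small(2)[OF assms(1)] by simp
  have "real (n s) * 1 \<le> c * ?X" using assms(2) b n by (intro mult_mono) auto
  then have cX: "real (n s) \<le> c * ?X" by simp
  have "norm (normalise (c *\<^sub>R column s 0 + column s (k - 1)) - normalise (column s 0)) \<le> 2 * ?Y / (c * ?X)"
    using b n assms(2) by (intro normalise_near_dominant) auto
  also have "\<dots> \<le> 2 * ?Y / real (n s)" using cX n b assms(2) by (intro divide_left_mono) auto
  also have "\<dots> \<le> (1 / 2) ^ (s + 1)"
    using last_column_small(1)[OF assms(1)] n by (simp add: pos_divide_le_eq)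
  finally show ?thesis .
qed

lemma cluster_tendsto: "cluster j \<longlonglongrightarrow> vertex j"
proof -
  have "norm (cluster j (Suc i) - cluster j i) \<le> (1 / 2) ^ i" for i
  proof -
    let ?s = "(k - 1) + j + i * (k - 1)"
    have s: "1 \<le> ?s" "(k - 1) + j + Suc i * (k - 1) = ?s + (k - 1)" using k_ge_2 by auto
    have "norm (cluster j (Suc i) - cluster j i) \<le> (1 / 2) ^ (?s + 1)"
      unfolding cluster_def s(2) column_period by (rule normalise_step[OF s(1)]) simp
    also have "\<dots> \<le> (1 / 2) ^ i"
    proof (rule power_decreasing)
      have "i * 1 \<le> i * (k - 1)" using k_ge_2 by (intro mult_le_mono2) auto
      then show "i \<le> ?s + 1" by linarith
    qed auto
    finally show ?thesis .
  qed
  then have "convergent (cluster j)" by (rule convergent_of_geometric_steps)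
  then show ?thesis unfolding vertex_def by (rule convergent_LIMSEQ_iff[THEN iffD1])
qed

text \<open>Stage \<open>(i + 2) * (k - 1)\<close> is one past the index of
  \<open>cluster (k - 2) i\<close>, and there the last column is dominated by exactly that
  vector.\<close>

lemma last_column_tendsto:
  "(\<lambda>i. normalise (column ((i + 2) * (k - 1)) (k - 1))) \<longlonglongrightarrow> vertex (k - 2)"
proof -
  have "norm (normalise (column ((i + 2) * (k - 1)) (k - 1)) - cluster (k - 2) i) \<le> (1 / 2) ^ i" for i
  proof -
    let ?s = "(k - 1) + (k - 2) + i * (k - 1)"
    have "(i + 2) * q = q + q + i * q" for q by (simp add: algebra_simps)
    then have s: "1 \<le> ?s" "(i + 2) * (k - 1) = Suc ?s" using k_ge_3 by auto
    have "norm (normalise (column ((i + 2) * (k - 1)) (k - 1)) - cluster (k - 2) i) \<le> (1 / 2) ^ (?s + 1)"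
      unfolding cluster_def s(2) column_last_Suc by (rule normalise_step[OF s(1)]) simp
    also have "\<dots> \<le> (1 / 2) ^ i"
    proof (rule power_decreasing)
      have "i * 1 \<le> i * (k - 1)" using k_ge_2 by (intro mult_le_mono2) auto
      then show "i \<le> ?s + 1" by linarith
    qed auto
    finally show ?thesis .
  qed
  then have "(\<lambda>i. normalise (column ((i + 2) * (k - 1)) (k - 1)) - cluster (k - 2) i) \<longlonglongrightarrow> 0"
    by (intro tendsto_norm_zero_cancel[OF tendsto_sandwich[OF _ _ tendsto_const LIMSEQ_realpow_zero[of "1/2"]]]) auto
  from tendsto_add[OF this cluster_tendsto[of "k - 2"]] show ?thesis by simp
qed

lemma vertex_in_fibre:
  assumes "j < k - 1"
  shows "vertex j \<in> Phi_fibre k e n"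
  unfolding fibre_eq
proof (intro CollectI conjI allI)
  have S: "coord_sum (cluster j i) = 1" for i
    unfolding cluster_def using coord_sum_column_bounds[of 0] k_ge_2
    by (intro coord_sum_normalise) (metis not_one_le_zero zero_less_numeral order_less_le_trans)
  have "(\<lambda>i. coord_sum (cluster j i)) \<longlonglongrightarrow> coord_sum (vertex j)"
    using linear_coord_sum by (intro bounded_linear.tendsto[OF _ cluster_tendsto]) (simp add: linear_conv_bounded_linear)
  then show "coord_sum (vertex j) = 1" unfolding S using LIMSEQ_unique tendsto_const by blast
  fix r
  have "(\<lambda>i. orbit r (cluster j i)) \<longlonglongrightarrow> orbit r (vertex j)"
    using linear_orbit by (intro bounded_linear.tendsto[OF _ cluster_tendsto]) (simp add: linear_conv_bounded_linear)
  moreover have "nonneg_vec (orbit r (cluster j i))" if "r \<le> i" for i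
  proof -
    have "i * 1 \<le> i * (k - 1)" using k_ge_2 by (intro mult_le_mono2) auto
    then have "r \<le> (k - 1) + j + i * (k - 1)" using that by linarith
    then show ?thesis
      unfolding cluster_def normalise_def linear_cmul[OF linear_orbit]
      using k_ge_2 by (intro nonneg_vec_scaleR nonneg_orbit_column) (auto simp: coord_sum_nonneg nonneg_column)
  qed
  then have "eventually (\<lambda>i. nonneg_vec (orbit r (cluster j i))) sequentially"
    by (intro eventually_sequentiallyI[of r])
  ultimately show "nonneg_vec (orbit r (vertex j))" by (rule nonneg_vec_tendsto)
qed

lemma fibre_subset_hull: "Phi_fibre k e n \<subseteq> convex hull (vertex ` {..<k - 1})"
proof
  fix x assume "x \<in> Phi_fibre k e n"
  then have x: "coord_sum x = 1" "\<And>r. nonneg_vec (orbit r x)" by (auto simp: fibre_eq)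
  define v where "v = (\<lambda>j. if j < k - 1 then vertex j else vertex (k - 2))"
  define f where "f = (\<lambda>i j. normalise (column ((i + 2) * (k - 1)) j))"
  define w where "w = (\<lambda>i j. orbit ((i + 2) * (k - 1)) x $ e (Suc j) * coord_sum (column ((i + 2) * (k - 1)) j))"
  have pos: "1 \<le> coord_sum (column s j)" if "j < k" for s j using coord_sum_column_bounds[OF that] by blast
  have f: "(\<lambda>i. f i j) \<longlonglongrightarrow> v j" if "j < k" for j
  proof (cases "j < k - 1")
    case True
    have "f i j = cluster j (Suc i)" for i
    proof -
      have "(i + 2) * (k - 1) + j = (k - 1) + j + Suc i * (k - 1)" by simp
      then show ?thesis unfolding f_def cluster_def column_shift[OF True] by (simp only:)
    qed
    then show ?thesis using LIMSEQ_Suc[OF cluster_tendsto] True by (simp add: v_def)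
  next
    case False
    then have "j = k - 1" using that by simp
    then show ?thesis using last_column_tendsto by (simp add: f_def v_def)
  qed
  have w_nonneg: "0 \<le> w i j" if "j < k" for i j
    unfolding w_def
  proof (rule mult_nonneg_nonneg)
    have "Suc j \<in> {1..k}" using that by auto
    then show "0 \<le> orbit ((i + 2) * (k - 1)) x $ e (Suc j)"
      using x(2)[of "(i + 2) * (k - 1)"] unfolding nonneg_vec_def by blast
    show "0 \<le> coord_sum (column ((i + 2) * (k - 1)) j)" by (rule coord_sum_nonneg[OF nonneg_column[OF that]])
  qed
  have x_eq: "x = (\<Sum>j<k. w i j *\<^sub>R f i j)" for i
  proof -
    have "x = (\<Sum>j<k. orbit ((i + 2) * (k - 1)) x $ e (Suc j) *\<^sub>R column ((i + 2) * (k - 1)) j)"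
      by (rule column_expansion)
    also have "\<dots> = (\<Sum>j<k. w i j *\<^sub>R f i j)"
    proof (intro sum.cong refl)
      fix j assume "j \<in> {..<k}"
      then have "coord_sum (column ((i + 2) * (k - 1)) j) \<noteq> 0" using pos[of j "(i + 2) * (k - 1)"] by auto
      then show "orbit ((i + 2) * (k - 1)) x $ e (Suc j) *\<^sub>R column ((i + 2) * (k - 1)) j = w i j *\<^sub>R f i j"
        by (simp add: w_def f_def normalise_def)
    qed
    finally show ?thesis .
  qed
  have w_sum: "(\<Sum>j<k. w i j) = 1" for i
  proof -
    have "coord_sum (f i j) = 1" if "j < k" for j
      unfolding f_def using pos[OF that, of "(i + 2) * (k - 1)"] by (intro coord_sum_normalise) auto
    then have "(\<Sum>j<k. w i j) = (\<Sum>j<k. coord_sum (w i j *\<^sub>R f i j))"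
      by (intro sum.cong refl) (simp add: linear_cmul[OF linear_coord_sum])
    also have "\<dots> = coord_sum x"
      unfolding linear_sum[OF linear_coord_sum, symmetric] x_eq[of i, symmetric] ..
    finally show ?thesis using x by simp
  qed
  have w_le: "w i j \<le> 1" if "j < k" for i j
    using member_le_sum[of j "{..<k}" "w i"] w_nonneg that w_sum[of i] by auto
  define y where "y = (\<lambda>i. \<Sum>j<k. w i j *\<^sub>R v j)"
  have "y i \<in> convex hull (vertex ` {..<k - 1})" for i
    unfolding y_def
  proof (rule convex_sum)
    fix j assume "j \<in> {..<k}"
    then show "v j \<in> convex hull (vertex ` {..<k - 1})"
      unfolding v_def using k_ge_2 by (auto intro!: hull_inc)
  qed (use w_nonneg w_sum in \<open>auto intro: convex_convex_hull\<close>)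
  moreover have "y \<longlonglongrightarrow> x"
  proof -
    have "norm (y i - x) \<le> (\<Sum>j<k. norm (v j - f i j))" for i
    proof -
      have "y i - x = y i - (\<Sum>j<k. w i j *\<^sub>R f i j)" by (simp only: x_eq[of i, symmetric])
      also have "\<dots> = (\<Sum>j<k. w i j *\<^sub>R (v j - f i j))"
        unfolding y_def by (simp add: sum_subtractf scaleR_diff_right)
      finally have "norm (y i - x) = norm (\<Sum>j<k. w i j *\<^sub>R (v j - f i j))" by (rule arg_cong)
      also have "\<dots> \<le> (\<Sum>j<k. norm (w i j *\<^sub>R (v j - f i j)))" by (rule norm_sum)
      also have "\<dots> \<le> (\<Sum>j<k. norm (v j - f i j))"
      proof (rule sum_mono)
        fix j assume j: "j \<in> {..<k}"
        then have "\<bar>w i j\<bar> \<le> 1" using w_nonneg[of j i] w_le[of j i] by simp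
        then show "norm (w i j *\<^sub>R (v j - f i j)) \<le> norm (v j - f i j)"
          by (simp add: mult_left_le_one_le)
      qed
      finally show ?thesis .
    qed
    moreover have "(\<lambda>i. \<Sum>j<k. norm (v j - f i j)) \<longlonglongrightarrow> (\<Sum>j<k. norm (v j - v j))"
      by (intro tendsto_intros f) auto
    ultimately have "(\<lambda>i. y i - x) \<longlonglongrightarrow> 0"
      by (intro Lim_null_comparison[of "\<lambda>i. y i - x" "\<lambda>i. \<Sum>j<k. norm (v j - f i j)"]) auto
    then show ?thesis by (simp add: LIM_zero_iff)
  qed
  moreover have "closed (convex hull (vertex ` {..<k - 1}))"
    by (intro compact_imp_closed finite_imp_compact_convex_hull) simp
  ultimately show "x \<in> convex hull (vertex ` {..<k - 1})"
    by (meson closed_sequentially)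
qed

lemma fibre_eq_hull: "Phi_fibre k e n = convex hull (vertex ` {..<k - 1})"
  using fibre_subset_hull hull_minimal[of "vertex ` {..<k - 1}" "Phi_fibre k e n" convex]
    vertex_in_fibre convex_fibre by blast

text \<open>The spare term \<open>(1 / 2) ^ s\<close> pays for the induction. The step from
  \<open>s\<close> to \<open>s + (k - 1)\<close> costs a relative margin of at most
  \<open>(1 / 2) ^ (s + 1)\<close>, and since \<open>k - 1\<close> is at least 2, at least
  \<open>(1 / 2) ^ (s + (k - 1))\<close> is left.\<close>

lemma dominance_column:
  assumes "j < k - 1" "1 \<le> j + i * (k - 1)"
  shows "(1 / 4 + (1 / 2) ^ (j + i * (k - 1))) * coord_sum (column (j + i * (k - 1)) 0)
    \<le> dominance j (column (j + i * (k - 1)) 0)"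
  using assms(2)
proof (induction i)
  case 0
  have "column j 0 = basis_vec j" using column_shift[OF assms(1), of 0] by simp
  moreover have "coord_sum (basis_vec j) = 1" "dominance j (basis_vec j) = 1"
    using assms(1) coord_sum_basis_vec[of j] by (auto simp: dominance_def basis_vec_nth)
  moreover have "(1 / 2 :: real) ^ j \<le> (1 / 2) ^ 1" using 0 by (intro power_decreasing) auto
  ultimately show ?case by simp
next
  case (Suc i)
  let ?s = "j + i * (k - 1)"
  let ?X = "coord_sum (column ?s 0)" and ?Y = "coord_sum (column ?s (k - 1))"
  have s: "j + Suc i * (k - 1) = ?s + (k - 1)" by simp
  have b: "1 \<le> ?X" "1 \<le> ?Y" "nonneg_vec (column ?s (k - 1))"
    using coord_sum_column_bounds[of 0 ?s] coord_sum_column_bounds[of "k - 1" ?s]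
      nonneg_column[of "k - 1" ?s] k_ge_2 by auto
  have half: "(1 / 2 :: real) ^ (?s + (k - 1)) \<le> (1 / 2) ^ (?s + 2)"
    using k_ge_3 by (intro power_decreasing) auto
  show ?case
  proof (cases "?s = 0")
    \<comment> \<open>The growth hypothesis does not control \<open>n 0\<close>, so this step is
      computed directly. Ignoring coordinate \<open>k\<close> matters here: counting it would lower
      the margin to \<open>n 0\<close>, which may be 0.\<close>
    case True
    have eq: "column (j + Suc i * (k - 1)) 0 = (real (n 0) + 1) *\<^sub>R basis_vec 0 + basis_vec (k - 1)"
      unfolding s True by (simp only: column_period column.simps(1))
    have sum: "coord_sum (column (j + Suc i * (k - 1)) 0) = real (n 0) + 2"
      unfolding eq using coord_sum_basis_vec k_ge_2
      by (simp add: linear_add[OF linear_coord_sum] linear_cmul[OF linear_coord_sum])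
    have "dominance 0 (basis_vec 0) = 1" "dominance 0 (basis_vec (k - 1)) = 0"
      using k_ge_3 coord_sum_basis_vec[of 0] coord_sum_basis_vec[of "k - 1"]
      by (auto simp: dominance_def basis_vec_nth)
    then have dom: "dominance j (column (j + Suc i * (k - 1)) 0) = real (n 0) + 1"
      unfolding eq using True by (simp add: linear_add[OF linear_dominance] linear_cmul[OF linear_dominance])
    have "(1 / 2 :: real) ^ (j + Suc i * (k - 1)) \<le> 1 / 4"
      using half unfolding s True by (simp add: power2_eq_square)
    then have "(1 / 4 + (1 / 2) ^ (j + Suc i * (k - 1))) * (real (n 0) + 2) \<le> (1 / 4 + 1 / 4) * (real (n 0) + 2)"
      by (intro mult_right_mono) auto
    also have "\<dots> \<le> real (n 0) + 1" by simp
    finally show ?thesis unfolding sum dom .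
  next
    case False
    then have s1: "1 \<le> ?s" by linarith
    let ?c = "real (n ?s) + 1"
    let ?t = "1 / 4 + (1 / 2 :: real) ^ ?s"
    have t: "?t \<le> 1" using power_decreasing[of 1 ?s "1 / 2 :: real"] s1 by simp
    \<comment> \<open>One \<open>?Y\<close> covers the margin of the last column, which may be as
      low as \<open>- ?Y\<close>; the other covers its share in the coordinate sum.\<close>
    have "2 * ?Y \<le> (1 / 2) ^ (?s + 1) * (?c * ?X + ?Y)"
    proof -
      have "real (n ?s) * 1 \<le> ?c * ?X" using b by (intro mult_mono) auto
      then have "(1 / 2) ^ (?s + 1) * real (n ?s) \<le> (1 / 2) ^ (?s + 1) * (?c * ?X + ?Y)"
        using b by (intro mult_left_mono) auto
      then show ?thesis using last_column_small(1)[OF s1] by linarith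
    qed
    moreover have "?t * (?c * ?X) + - ?Y \<le> ?c * dominance j (column ?s 0) + dominance j (column ?s (k - 1))"
    proof (rule add_mono)
      have "?c * (?t * ?X) \<le> ?c * dominance j (column ?s 0)"
        using Suc.IH[OF s1] by (intro mult_left_mono) auto
      then show "?t * (?c * ?X) \<le> ?c * dominance j (column ?s 0)" by (simp only: mult_ac)
      show "- ?Y \<le> dominance j (column ?s (k - 1))"
        using dominance_ge[OF b(3), of j] assms(1) by simp
    qed
    moreover have "?t * ?Y \<le> 1 * ?Y" using t b by (intro mult_right_mono) auto
    moreover have "(1 / 4 + (1 / 2) ^ (?s + (k - 1))) * (?c * ?X + ?Y)
        \<le> (?t - (1 / 2) ^ (?s + 1)) * (?c * ?X + ?Y)"
    proof (rule mult_right_mono)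
      have "(1 / 2 :: real) ^ (?s + 2) \<le> (1 / 2) ^ ?s - (1 / 2) ^ (?s + 1)" by simp
      then show "1 / 4 + (1 / 2) ^ (?s + (k - 1)) \<le> ?t - (1 / 2) ^ (?s + 1)" using half by linarith
      show "0 \<le> ?c * ?X + ?Y" using b by auto
    qed
    ultimately show ?thesis
      unfolding s column_period
      by (simp only: linear_add[OF linear_coord_sum] linear_cmul[OF linear_coord_sum]
          linear_add[OF linear_dominance] linear_cmul[OF linear_dominance] distrib_left left_diff_distrib real_scaleR_def)
  qed
qed

lemma dominance_vertex:
  assumes "j < k - 1"
  shows "1 / 4 \<le> dominance j (vertex j)"
proof -
  have "(\<lambda>i. dominance j (cluster j i)) \<longlonglongrightarrow> dominance j (vertex j)"
    using linear_dominance by (intro bounded_linear.tendsto[OF _ cluster_tendsto]) (simp add: linear_conv_bounded_linear)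
  moreover have "1 / 4 \<le> dominance j (cluster j i)" for i
  proof -
    let ?s = "j + Suc i * (k - 1)"
    have s: "(k - 1) + j + i * (k - 1) = ?s" by simp
    have X: "1 \<le> coord_sum (column ?s 0)" using coord_sum_column_bounds[of 0 ?s] k_ge_2 by auto
    have "1 / 4 * coord_sum (column ?s 0) \<le> (1 / 4 + (1 / 2) ^ ?s) * coord_sum (column ?s 0)"
      using X by (intro mult_right_mono) auto
    also have "\<dots> \<le> dominance j (column ?s 0)"
      using assms k_ge_2 by (intro dominance_column) auto
    finally show ?thesis
      unfolding cluster_def s normalise_def linear_cmul[OF linear_dominance] using X
      by (simp add: field_simps)
  qed
  ultimately show ?thesis by (intro LIMSEQ_le_const) auto
qed

lemma nonneg_vertex: "j < k - 1 \<Longrightarrow> nonneg_vec (vertex j)"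
  using vertex_in_fibre[of j] by (auto simp: fibre_eq dest: spec[of _ 0])

text \<open>In coordinate \<open>m\<close> the diagonal term is bounded by the off-diagonal ones.
  Summing over \<open>m\<close> and collecting by rows makes a sum of \<open>\<bar>c i\<bar>\<close>
  times row margins nonpositive, while each margin is at least 1/4.\<close>

lemma vertex_combination_zero:
  assumes "(\<Sum>j<k - 1. c j *\<^sub>R vertex j) = 0" "j < k - 1"
  shows "c j = 0"
proof -
  let ?L = "k - 1"
  let ?a = "\<lambda>i m. vertex i $ e (Suc m)"
  have nn: "0 \<le> ?a i m" if "i < ?L" "m < ?L" for i m
    using nonneg_vertex[OF that(1)] that by (auto simp: nonneg_vec_def)
  have dom: "1 / 4 \<le> 2 * ?a i i - (\<Sum>m<?L. ?a i m)" if "i < ?L" for i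
  proof -
    have "(\<Sum>m<?L. ?a i m) + vertex i $ e k = (\<Sum>m<Suc ?L. ?a i m)"
      by (subst sum.lessThan_Suc) (use k_ge_2 in simp)
    also have "\<dots> = coord_sum (vertex i)"
      unfolding coord_sum_def
      by (rule sum.reindex_bij_witness[of _ "\<lambda>j. j - 1" Suc]) (use k_ge_2 in auto)
    finally show ?thesis using dominance_vertex[OF that] by (simp add: dominance_def)
  qed
  have "(\<Sum>m<?L. \<bar>c m\<bar> * (2 * ?a m m)) \<le> (\<Sum>m<?L. \<Sum>i<?L. \<bar>c i\<bar> * ?a i m)"
  proof (rule sum_mono)
    fix m assume m: "m \<in> {..<?L}"
    have "(\<Sum>i<?L. c i *\<^sub>R vertex i) $ e (Suc m) = 0" using assms(1) by simp
    then have "(\<Sum>i<?L. c i * ?a i m) = 0" by (simp add: sum_component)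
    then have "c m * ?a m m = - (\<Sum>i\<in>{..<?L} - {m}. c i * ?a i m)"
      using m by (simp add: sum.remove[of _ m])
    then have "\<bar>c m\<bar> * ?a m m = \<bar>\<Sum>i\<in>{..<?L} - {m}. c i * ?a i m\<bar>"
      using nn[of m m] m by (metis abs_minus_cancel abs_mult abs_of_nonneg lessThan_iff)
    also have "\<dots> \<le> (\<Sum>i\<in>{..<?L} - {m}. \<bar>c i\<bar> * ?a i m)"
      by (rule order_trans[OF sum_abs]) (use nn m in \<open>auto intro!: sum_mono simp: abs_mult\<close>)
    also have "\<dots> = (\<Sum>i<?L. \<bar>c i\<bar> * ?a i m) - \<bar>c m\<bar> * ?a m m"
      using m by (simp add: sum.remove[of _ m])
    finally show "\<bar>c m\<bar> * (2 * ?a m m) \<le> (\<Sum>i<?L. \<bar>c i\<bar> * ?a i m)" by simp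
  qed
  also have "\<dots> = (\<Sum>i<?L. \<bar>c i\<bar> * (\<Sum>m<?L. ?a i m))"
    by (subst sum.swap) (simp add: sum_distrib_left)
  finally have "(\<Sum>i<?L. \<bar>c i\<bar> * (2 * ?a i i - (\<Sum>m<?L. ?a i m))) \<le> 0"
    by (simp add: right_diff_distrib sum_subtractf)
  moreover have "(\<Sum>i<?L. \<bar>c i\<bar> * (1 / 4)) \<le> (\<Sum>i<?L. \<bar>c i\<bar> * (2 * ?a i i - (\<Sum>m<?L. ?a i m)))"
    using dom by (intro sum_mono mult_left_mono) auto
  ultimately have "(\<Sum>i<?L. \<bar>c i\<bar>) \<le> 0" by (simp add: sum_divide_distrib[symmetric])
  moreover have "\<bar>c j\<bar> \<le> (\<Sum>i<?L. \<bar>c i\<bar>)" using assms(2) by (intro member_le_sum) auto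
  ultimately show ?thesis by simp
qed

lemma inj_vertex: "inj_on vertex {..<k - 1}"
proof (rule inj_onI, rule ccontr)
  fix i j assume ij: "i \<in> {..<k - 1}" "j \<in> {..<k - 1}" "vertex i = vertex j" "i \<noteq> j"
  define c where "c = (\<lambda>m. if m = i then 1 else if m = j then - 1 else 0 :: real)"
  have "(\<Sum>m<k - 1. c m *\<^sub>R vertex m) = (\<Sum>m\<in>{i, j}. c m *\<^sub>R vertex m)"
    by (rule sum.mono_neutral_right) (use ij in \<open>auto simp: c_def\<close>)
  also have "\<dots> = 0" using ij by (simp add: c_def)
  finally have "c i = 0" by (rule vertex_combination_zero) (use ij in auto)
  then show False by (simp add: c_def)
qed

lemma independent_vertices: "independent (vertex ` {..<k - 1})"
proof (rule independent_if_scalars_zero)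
  fix f x assume f: "(\<Sum>x\<in>vertex ` {..<k - 1}. f x *\<^sub>R x) = 0" and "x \<in> vertex ` {..<k - 1}"
  then obtain j where j: "j < k - 1" "x = vertex j" by auto
  have "(\<Sum>j<k - 1. f (vertex j) *\<^sub>R vertex j) = 0"
    using f unfolding sum.reindex[OF inj_vertex] comp_def .
  then show "f x = 0" using vertex_combination_zero[of "\<lambda>j. f (vertex j)"] j by simp
qed simp

text \<open>Linear independence gives affine independence, and dimension \<open>k - 2\<close> means
  \<open>k - 1\<close> vertices.\<close>

lemma fibre_simplex: "(int k - 2) simplex Phi_fibre k e n"
  unfolding simplex fibre_eq_hull
  using independent_vertices affine_dependent_imp_dependent card_image[OF inj_vertex] k_ge_2
  by (intro exI[of _ "vertex ` {..<k - 1}"]) auto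

lemma fibre_not_singleton: "Phi_fibre k e n \<noteq> {x}"
proof
  assume "Phi_fibre k e n = {x}"
  then have "vertex 0 = vertex 1" using vertex_in_fibre[of 0] vertex_in_fibre[of 1] k_ge_3 by auto
  then have "(0 :: nat) = 1" by (rule inj_onD[OF inj_vertex]) (use k_ge_3 in auto)
  then show False by simp
qed

end

end

theorem theorem27:
  fixes k :: nat and e :: "nat \<Rightarrow> 'i::finite" and \<alpha> :: "real ^ 'i" and n :: "nat \<Rightarrow> nat"
  assumes "k \<ge> 2"
    and "bij_betw e {1..k} (UNIV :: 'i set)"
    and "\<alpha> \<in> Delta k e"
    and "n = Phi k e \<alpha>"
  shows "((\<forall>r. n r > 0) \<and> (\<exists>C::real. \<forall>r\<ge>1. real (n r) \<le> C * (real r)\<^sup>2) \<longrightarrow> regular k e \<alpha>) \<and>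
    (k \<ge> 3 \<and> (\<forall>r\<ge>1. n r \<ge> 2 ^ (r + 2) * (\<Prod>i=0..<r. (n i + 2))) \<longrightarrow>
      (int k - 2) simplex Phi_fibre k e (Phi k e \<alpha>) \<and> exceptional k e \<alpha>)"
proof -
  interpret itinerary_map k e n by unfold_locales (use assms in auto)
  have mem: "\<alpha> \<in> Phi_fibre k e n" using assms by (simp add: Phi_fibre_def)
  show ?thesis
  proof (intro conjI impI; elim conjE)
    assume pos: "\<forall>r. n r > 0" and "\<exists>C::real. \<forall>r\<ge>1. real (n r) \<le> C * (real r)\<^sup>2"
    then obtain C :: real where C: "\<forall>r\<ge>1. real (n r) \<le> C * (real r)\<^sup>2" by blast
    have "\<beta> = \<alpha>" if "\<beta> \<in> Phi_fibre k e n" for \<beta>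
      by (rule fibre_unique[OF _ _ that mem]) (use pos C in auto)
    then have "Phi_fibre k e n = {\<alpha>}" using mem by blast
    then show "regular k e \<alpha>" using assms by (simp add: regular_def)
  next
    assume k: "k \<ge> 3" and g: "\<forall>r\<ge>1. n r \<ge> 2 ^ (r + 2) * (\<Prod>i=0..<r. (n i + 2))"
    show "(int k - 2) simplex Phi_fibre k e (Phi k e \<alpha>)"
      using fibre_simplex[OF k] g assms(4) by simp
    have "Phi_fibre k e n \<noteq> {\<alpha>}" by (rule fibre_not_singleton[OF k]) (use g in auto)
    then show "exceptional k e \<alpha>" using assms by (simp add: exceptional_def regular_def)
  qed
qed

end
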